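(* Let $G$ be a connected unicyclic graph on $n$ vertices whose unique cycle has size $c\ge 3$. Let $k$ be the number of internal edges of $G$ and let $r\ge 0$ be the number of non-trivial rooted trees attached to the cycle of $G$. Write the star-expansion $\mathbf{X}_G=\sum_{\lambda\vdash n}c_\lambda\,\mathfrak{st}_\lambda$. Then for every hook partition $(n-m_1,1^{m_1})$ with $0\le m_1\le n-2$, \[ c_{(n-m_1,1^{m_1})}=(-1)^{m_1}\left[(r-1)\binom{k-2}{m_1-1}+(c-1)\binom{k-2}{m_1}\right]. \]
   Context: All graphs are finite and simple. The chromatic symmetric function of a graph $G$ with vertices $v_1,\dots,v_n$ is $\mathbf{X}_G=\sum_\kappa x_{\kappa(v_1)}\cdots x_{\kappa(v_n)}$, summed over all proper colorings $\kappa:V(G)\to\mathbb{N}$. The star graph $\mathsf{St}_k$ on $k$ vertices is the tree with one central vertex adjacent to $k-1$ leaves ($\mathsf{St}_1$ is a single vertex); $\mathfrak{st}_k:=\mathbf{X}_{\mathsf{St}_k}$, and for a partition $\lambda=(\lambda_1,\dots,\lambda_\ell)$, $\mathfrak{st}_\lambda:=\mathfrak{st}_{\lambda_1}\cdots\mathfrak{st}_{\lambda_\ell}$. The set $\{\mathfrak{st}_\lambda:\lambda\vdash n\}$ is a $\mathbb{Q}$-basis (the star-basis) of the space of homogeneous symmetric functions of degree $n$, so $\mathbf{X}_G=\sum_{\lambda\vdash n}c_\lambda\mathfrak{st}_\lambda$ with uniquely determined coefficients $c_\lambda$ (the star-expansion). A unicyclic graph is a graph containing exactly one cycle. If $G$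 is connected unicyclic with cycle vertices $v_1,\dots,v_c$, then deleting the edges of the cycle leaves $c$ trees $T_1,\dots,T_c$ with $T_i$ containing (and rooted at) $v_i$; $T_i$ is non-trivial if it has more than one vertex, and $r$ denotes the number of non-trivial $T_i$. A leaf is a vertex of degree one; an internal vertex is a vertex of degree at least two; an internal edge is an edge both of whose endpoints are internal vertices. Binomial coefficients $\binom{a}{b}$ with $a\ge0$ are $0$ when $b<0$ or $b>a$. *)

theory Defs
  imports Complex_Main "HOL-Library.Multiset" "HOL-Library.FuncSet"
begin

section \<open>Power series in countably many commuting variables\<close>

text \<open>
  A multiset \<open>M\<close> of naturals stands for the monomial \<open>\<Prod>i\<in>#M. x\<^sub>i\<close>; a power series over the
  rationals is the function assigning to each monomial its coefficient. Symmetric functions are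
  particular elements of this ring.
\<close>

typedef pseries = "UNIV :: (nat multiset \<Rightarrow> rat) set"
  morphisms pcoeff Abs_pseries ..

setup_lifting type_definition_pseries

lemma pseries_eqI: "(\<And>M. pcoeff f M = pcoeff g M) \<Longrightarrow> f = g"
  by (simp add: pcoeff_inject[symmetric] fun_eq_iff)

definition splits :: "nat multiset \<Rightarrow> (nat multiset \<times> nat multiset) set" where
  "splits M = {(A, B). A + B = M}"

lemma finite_splits [simp]: "finite (splits M)"
proof -
  have "finite {A. A \<subseteq># M}" for M :: "nat multiset"
  proof (induction M)
    case (add x M)
    have "{A. A \<subseteq># add_mset x M} \<subseteq> {A. A \<subseteq># M} \<union> add_mset x ` {A. A \<subseteq># M}"
    proof
      fix A assume A: "A \<in> {A. A \<subseteq># add_mset x M}"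
      show "A \<in> {A. A \<subseteq># M} \<union> add_mset x ` {A. A \<subseteq># M}"
      proof (cases "x \<in># A")
        case True
        then obtain B where B: "A = add_mset x B" by (metis multi_member_split)
        with A show ?thesis by simp
      next
        case False
        then have "A - {#x#} = A" by simp
        moreover from A have "A - {#x#} \<subseteq># M"
          by (simp add: subset_eq_diff_conv)
        ultimately show ?thesis by simp
      qed
    qed
    then show ?case using add by (meson finite_UnI finite_imageI finite_subset)
  qed simp
  moreover have "splits M \<subseteq> {A. A \<subseteq># M} \<times> {A. A \<subseteq># M}"
    by (auto simp: splits_def)
  ultimately show ?thesis by (meson finite_SigmaI finite_subset)
qed

instantiation pseries :: comm_ring_1
begin

lift_definition zero_pseries :: pseries is "\<lambda>_. 0" .
lift_definition one_pseries :: pseries is "\<lambda>M. if M = {#} then 1 else 0" .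
lift_definition plus_pseries :: "pseries \<Rightarrow> pseries \<Rightarrow> pseries" is "\<lambda>f g M. f M + g M" .
lift_definition minus_pseries :: "pseries \<Rightarrow> pseries \<Rightarrow> pseries" is "\<lambda>f g M. f M - g M" .
lift_definition uminus_pseries :: "pseries \<Rightarrow> pseries" is "\<lambda>f M. - f M" .
lift_definition times_pseries :: "pseries \<Rightarrow> pseries \<Rightarrow> pseries" is
  "\<lambda>f g M. \<Sum>(A, B)\<in>splits M. f A * g B" .

instance
proof
  fix a b c :: pseries
  show "a + b + c = a + (b + c)" by transfer (simp add: fun_eq_iff)
  show "a + b = b + a" by transfer (simp add: fun_eq_iff)
  show "0 + a = a" by transfer simp
  show "- a + a = 0" by transfer simp
  show "a - b = a + - b" by transfer simp
  show "(0::pseries) \<noteq> 1" by transfer (simp add: fun_eq_iff)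
  show "(a + b) * c = a * c + b * c"
    by transfer (simp add: fun_eq_iff distrib_right sum.distrib case_prod_unfold)
  show "a * b = b * a"
  proof (rule pseries_eqI)
    fix M
    show "pcoeff (a * b) M = pcoeff (b * a) M"
      unfolding times_pseries.rep_eq
      by (rule sum.reindex_bij_witness[of _ prod.swap prod.swap])
        (auto simp: splits_def ac_simps)
  qed
  show "1 * a = a"
  proof (rule pseries_eqI)
    fix M
    have "pcoeff (1 * a) M = (\<Sum>(A, B)\<in>{({#}, M)}. pcoeff 1 A * pcoeff a B)"
      unfolding times_pseries.rep_eq
    proof (rule sum.mono_neutral_right)
      show "finite (splits M)" by (rule finite_splits)
      show "{({#}, M)} \<subseteq> splits M" by (simp add: splits_def)
      show "\<forall>i\<in>splits M - {({#}, M)}. (case i of (A, B) \<Rightarrow> pcoeff 1 A * pcoeff a B) = 0"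
        by (auto simp: splits_def one_pseries.rep_eq split: if_splits)
    qed
    then show "pcoeff (1 * a) M = pcoeff a M" by (simp add: one_pseries.rep_eq)
  qed
  show "a * b * c = a * (b * c)"
  proof (rule pseries_eqI)
    fix M
    let ?L = "Sigma (splits M) (\<lambda>x. splits (fst x))"
    let ?R = "Sigma (splits M) (\<lambda>x. splits (snd x))"
    have "pcoeff (a * b * c) M = (\<Sum>x\<in>splits M. \<Sum>y\<in>splits (fst x).
        pcoeff a (fst y) * pcoeff b (snd y) * pcoeff c (snd x))"
      by (simp add: times_pseries.rep_eq sum_distrib_right case_prod_unfold)
    also have "\<dots> = (\<Sum>(x, y)\<in>?L. pcoeff a (fst y) * pcoeff b (snd y) * pcoeff c (snd x))"
      by (rule sum.Sigma) simp_all
    also have "\<dots> = (\<Sum>(x, y)\<in>?R. pcoeff a (fst x) * pcoeff b (fst y) * pcoeff c (snd y))"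
      by (rule sum.reindex_bij_witness[of _
            "\<lambda>((A, Q), (B, C)). ((A + B, C), (A, B))" "\<lambda>((P, C), (A, B)). ((A, B + C), (B, C))"])
        (auto simp: splits_def add.assoc)
    also have "\<dots> = (\<Sum>x\<in>splits M. \<Sum>y\<in>splits (snd x).
        pcoeff a (fst x) * pcoeff b (fst y) * pcoeff c (snd y))"
      by (rule sum.Sigma[symmetric]) simp_all
    also have "\<dots> = pcoeff (a * (b * c)) M"
      by (simp add: times_pseries.rep_eq sum_distrib_left case_prod_unfold mult.assoc)
    finally show "pcoeff (a * b * c) M = pcoeff (a * (b * c)) M" .
  qed
qed

end

lift_definition scale_pseries :: "rat \<Rightarrow> pseries \<Rightarrow> pseries" is "\<lambda>q f M. q * f M" .


section \<open>Finite simple graphs\<close>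

definition simple_graph :: "'a set \<Rightarrow> 'a set set \<Rightarrow> bool" where
  "simple_graph V E \<longleftrightarrow> finite V \<and> (\<forall>e\<in>E. e \<subseteq> V \<and> card e = 2)"

definition adj :: "'a set set \<Rightarrow> ('a \<times> 'a) set" where
  "adj E = {(u, v). {u, v} \<in> E}"

definition component_of :: "'a set set \<Rightarrow> 'a \<Rightarrow> 'a set" where
  "component_of E v = {w. (v, w) \<in> (adj E)\<^sup>*}"

definition connected_graph :: "'a set \<Rightarrow> 'a set set \<Rightarrow> bool" where
  "connected_graph V E \<longleftrightarrow> V \<noteq> {} \<and> (\<forall>u\<in>V. \<forall>v\<in>V. (u, v) \<in> (adj E)\<^sup>*)"

definition vertex_degree :: "'a set set \<Rightarrow> 'a \<Rightarrow> nat" where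
  "vertex_degree E v = card {e \<in> E. v \<in> e}"

definition internal_vertex :: "'a set set \<Rightarrow> 'a \<Rightarrow> bool" where
  "internal_vertex E v \<longleftrightarrow> vertex_degree E v \<ge> 2"

definition internal_edges :: "'a set set \<Rightarrow> 'a set set" where
  "internal_edges E = {e \<in> E. \<forall>v\<in>e. internal_vertex E v}"

text \<open>
  A cycle is identified with its set of edges, so that starting point and orientation do not
  matter when cycles are counted; its vertex set is \<open>\<Union>C\<close>.
\<close>

definition is_cycle :: "'a set set \<Rightarrow> 'a set set \<Rightarrow> bool" where
  "is_cycle E C \<longleftrightarrow> C \<subseteq> E \<and>
    (\<exists>vs. distinct vs \<and> length vs \<ge> 3 \<and>
      C = {{vs ! i, vs ! (Suc i mod length vs)} | i. i < length vs})"

definition unicyclic :: "'a set set \<Rightarrow> bool" where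
  "unicyclic E \<longleftrightarrow> (\<exists>!C. is_cycle E C)"

definition the_cycle :: "'a set set \<Rightarrow> 'a set set" where
  "the_cycle E = (THE C. is_cycle E C)"

text \<open>
  The vertex set of the tree rooted at the cycle vertex \<open>v\<close>: the component of \<open>v\<close> after deletion
  of the edges of the cycle.
\<close>

definition rooted_tree :: "'a set set \<Rightarrow> 'a \<Rightarrow> 'a set" where
  "rooted_tree E v = component_of (E - the_cycle E) v"

definition nontrivial_roots :: "'a set set \<Rightarrow> 'a set" where
  "nontrivial_roots E = {v \<in> \<Union>(the_cycle E). card (rooted_tree E v) > 1}"


section \<open>Chromatic symmetric functions and the star-basis\<close>

text \<open>
  Colorings are extensional (\<open>undefined\<close> outside \<open>V\<close>), so that each map \<open>V \<rightarrow> \<nat>\<close> is counted once.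
\<close>

definition proper_colorings :: "'a set \<Rightarrow> 'a set set \<Rightarrow> ('a \<Rightarrow> nat) set" where
  "proper_colorings V E =
    {\<kappa> \<in> V \<rightarrow>\<^sub>E UNIV. \<forall>u v. {u, v} \<in> E \<longrightarrow> \<kappa> u \<noteq> \<kappa> v}"

text \<open>
  The infinite sum \<open>\<Sum>\<kappa>. \<Prod>v\<in>V. x\<^bsub>\<kappa> v\<^esub>\<close> taken coefficientwise: the coefficient of the
  monomial \<open>M\<close> is the number of proper colorings whose monomial is \<open>M\<close>. For finite \<open>V\<close> this
  number is finite.
\<close>

definition chromatic_sf :: "'a set \<Rightarrow> 'a set set \<Rightarrow> pseries" where
  "chromatic_sf V E = Abs_pseries (\<lambda>M.
    of_nat (card {\<kappa> \<in> proper_colorings V E. image_mset \<kappa> (mset_set V) = M}))"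

definition star_sf :: "nat \<Rightarrow> pseries" where
  "star_sf k = chromatic_sf {0..<k} {{0, i} | i. 1 \<le> i \<and> i < k}"

text \<open>Partitions are the multisets of their (positive) parts.\<close>

definition partitions_of :: "nat \<Rightarrow> nat multiset set" where
  "partitions_of n = {p. 0 \<notin># p \<and> sum_mset p = n}"

lemma finite_partitions_of [simp]: "finite (partitions_of n)"
proof -
  have le: "size p \<le> sum_mset p \<and> (\<forall>x\<in>#p. x \<le> sum_mset p)" if "0 \<notin># p" for p :: "nat multiset"
    using that by (induction p) auto
  have "partitions_of n \<subseteq> mset ` {xs. set xs \<subseteq> {..n} \<and> length xs \<le> n}"
  proof
    fix p assume p: "p \<in> partitions_of n"
    obtain xs where xs: "mset xs = p" by (metis ex_mset)
    have "size p \<le> n" "set_mset p \<subseteq> {..n}"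
      using p le[of p] unfolding partitions_of_def by blast+
    then have "set xs \<subseteq> {..n}" "length xs \<le> n"
      unfolding xs[symmetric] by simp_all
    with xs show "p \<in> mset ` {xs. set xs \<subseteq> {..n} \<and> length xs \<le> n}" by blast
  qed
  then show ?thesis by (rule finite_surj[OF finite_lists_length_le[OF finite_atMost]])
qed

definition star_prod :: "nat multiset \<Rightarrow> pseries" where
  "star_prod p = (\<Prod>k\<in>#p. star_sf k)"

definition is_star_expansion :: "nat \<Rightarrow> pseries \<Rightarrow> (nat multiset \<Rightarrow> rat) \<Rightarrow> bool" where
  "is_star_expansion n X a \<longleftrightarrow>
    (\<forall>p. p \<notin> partitions_of n \<longrightarrow> a p = 0) \<and>
    X = (\<Sum>p\<in>partitions_of n. scale_pseries (a p) (star_prod p))"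

text \<open>
  \<open>THE\<close> is well defined for homogeneous symmetric \<open>X\<close> of degree \<open>n\<close>, because the \<open>star_prod p\<close>
  with \<open>p\<close> a partition of \<open>n\<close> form a basis of that space.
\<close>

definition star_coeff :: "nat \<Rightarrow> pseries \<Rightarrow> nat multiset \<Rightarrow> rat" where
  "star_coeff n X = (THE a. is_star_expansion n X a)"

definition hook :: "nat \<Rightarrow> nat \<Rightarrow> nat multiset" where
  "hook n m = add_mset (n - m) (replicate_mset m 1)"

text \<open>Integer arguments, since the lower index in the formula can be \<open>-1\<close>; used only for \<open>a \<ge> 0\<close>.\<close>

definition int_binomial :: "int \<Rightarrow> int \<Rightarrow> rat" where
  "int_binomial a b = (if b < 0 \<or> b > a then 0 else of_nat (nat a choose nat b))"

end

(* Fix h = n - 1 - m1. The power sum p_k counts monochromatic colorings of k vertices, and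
   inclusion-exclusion over the leaves colored differently from the center gives
   p_k = sum_j (-1)^j (k-1 choose j) st_(j+1) st_1^(k-1-j). A product of parts is a hook
   (h+1, 1, ..., 1) only if exactly one factor contributes its part h+1 and all others contribute
   only ones, so the hook coefficient of p_lambda is the sum of (-1)^h (k-1 choose h) over the
   parts k of lambda.

   Substituting this into X_G = sum_(S <= E) (-1)^|S| prod_(K component of S) p_|K| and summing
   first over K leaves sum_K (-1)^h (|K|-1 choose h) a(K), where a(K) is the signed count of
   connected spanning edge sets of G[K] if V - K is independent, and 0 otherwise.

   A connected unicyclic graph arises from its cycle by attaching pendant vertices one at a time.
   Induction along this construction determines a(K): up to the sign (-1)^(|K|-1) it is c - 1 if K
   contains all internal vertices, 1 if K misses exactly one of them and that one is a cycle vertex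
   of degree 2 (there are c - r of these), and 0 otherwise. The remaining sum over the subsets of
   leaves in K is an iterated finite difference of binomial coefficients, and the number of internal
   vertices equals the number k of internal edges. *)
theory Submission
  imports Defs
begin

section \<open>Weighted coloring series\<close>

text \<open>\<open>star_coeff\<close> is a definite description, so an expansion found by any route
  yields it only once uniqueness is known. Uniqueness is drawn from power sums: their products are
  independent, because a monomial with as many variables as p has parts determines p, and they lie
  in the span of the star products. A relation among the star products would leave too few of them
  to span. The bound m1 <= n - 2 means h >= 1; for h = 0 the large part h + 1 could not be told from
  the parts 1. The factor c - 1 comes from the cycle itself, whose c spanning paths count against
  its full edge set. A cycle vertex of degree 2 may be left out of K, since the rest stays
  connected. A cycle vertex that carries a tree may not: covering would force its tree neighbours
  into K, where they would be cut off from the rest. Pascal's rule turns (c - 1) C(k-1, m1) - (c -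
  r) C(k-2, m1-1) into the stated bracket, with r - 1 = (c - 1) - (c - r).\<close>

interpretation pser: vector_space scale_pseries
  by unfold_locales (transfer; simp add: fun_eq_iff algebra_simps)+

lemma pcoeff_sum: "pcoeff (\<Sum>i\<in>I. f i) M = (\<Sum>i\<in>I. pcoeff (f i) M)"
  by (induction I rule: infinite_finite_induct)
    (simp_all add: zero_pseries.rep_eq plus_pseries.rep_eq)

lemma scale_mult_scale:
  "scale_pseries a f * scale_pseries b g = scale_pseries (a * b) (f * g)"
  by (rule pseries_eqI)
    (simp add: times_pseries.rep_eq scale_pseries.rep_eq sum_distrib_left case_prod_unfold ac_simps)

definition colorings_of_type :: "'a set \<Rightarrow> nat multiset \<Rightarrow> ('a \<Rightarrow> nat) set" where
  "colorings_of_type V M = {\<kappa> \<in> V \<rightarrow>\<^sub>E UNIV. image_mset \<kappa> (mset_set V) = M}"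

text \<open>Arbitrary weights in place of the properness condition allow signed expansions of its
  indicator to be carried out pointwise in \<kappa>.\<close>

definition color_series :: "'a set \<Rightarrow> (('a \<Rightarrow> nat) \<Rightarrow> rat) \<Rightarrow> pseries" where
  "color_series V w = Abs_pseries (\<lambda>M. \<Sum>\<kappa>\<in>colorings_of_type V M. w \<kappa>)"

lemma pcoeff_color_series:
  "pcoeff (color_series V w) M = (\<Sum>\<kappa>\<in>colorings_of_type V M. w \<kappa>)"
  by (simp add: color_series_def Abs_pseries_inverse)

lemma finite_colorings_of_type [simp]:
  assumes "finite V"
  shows "finite (colorings_of_type V M)"
proof (rule finite_subset)
  show "colorings_of_type V M \<subseteq> V \<rightarrow>\<^sub>E set_mset M"
    using assms by (auto simp: colorings_of_type_def PiE_def)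
  show "finite (V \<rightarrow>\<^sub>E set_mset M)"
    using assms by (simp add: finite_PiE)
qed

lemma color_series_cong:
  assumes "\<And>\<kappa>. \<kappa> \<in> V \<rightarrow>\<^sub>E UNIV \<Longrightarrow> w \<kappa> = w' \<kappa>"
  shows "color_series V w = color_series V w'"
  by (rule pseries_eqI)
    (auto simp: pcoeff_color_series colorings_of_type_def intro!: sum.cong assms)

lemma color_series_sum:
  "color_series V (\<lambda>\<kappa>. \<Sum>i\<in>I. c i * w i \<kappa>) = (\<Sum>i\<in>I. scale_pseries (c i) (color_series V (w i)))"
  by (rule pseries_eqI, simp add: pcoeff_color_series pcoeff_sum scale_pseries.rep_eq sum_distrib_left)
    (rule sum.swap)

lemma chromatic_sf_eq_color_series:
  assumes "finite V"
  shows "chromatic_sf V E = color_series V (\<lambda>\<kappa>. of_bool (\<forall>u v. {u, v} \<in> E \<longrightarrow> \<kappa> u \<noteq> \<kappa> v))"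
proof (rule pseries_eqI)
  fix M
  have "{\<kappa> \<in> proper_colorings V E. image_mset \<kappa> (mset_set V) = M} =
    {\<kappa> \<in> colorings_of_type V M. \<forall>u v. {u, v} \<in> E \<longrightarrow> \<kappa> u \<noteq> \<kappa> v}"
    by (auto simp: proper_colorings_def colorings_of_type_def)
  then show "pcoeff (chromatic_sf V E) M =
      pcoeff (color_series V (\<lambda>\<kappa>. of_bool (\<forall>u v. {u, v} \<in> E \<longrightarrow> \<kappa> u \<noteq> \<kappa> v))) M"
    using assms
    by (simp add: chromatic_sf_def Abs_pseries_inverse pcoeff_color_series Int_def
        flip: sum.inter_filter)
qed

text \<open>Renaming the vertices preserves the monomial of a coloring, so only the weights have to
  match. The \<open>restrict\<close> keeps the pulled-back coloring extensional.\<close>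

lemma color_series_bij:
  assumes fin: "finite V" and f: "bij_betw f V V'"
    and w: "\<And>\<kappa>. \<kappa> \<in> V' \<rightarrow>\<^sub>E UNIV \<Longrightarrow> w' \<kappa> = w (restrict (\<kappa> \<circ> f) V)"
  shows "color_series V' w' = color_series V w"
proof (rule pseries_eqI)
  fix M
  define g where "g = inv_into V f"
  have g: "\<And>x. x \<in> V \<Longrightarrow> g (f x) = x" "\<And>y. y \<in> V' \<Longrightarrow> f (g y) = y" "\<And>y. y \<in> V' \<Longrightarrow> g y \<in> V"
    using f unfolding g_def
    by (auto simp: bij_betw_def bij_betw_inv_into_left[OF f] bij_betw_inv_into_right[OF f] inv_into_into)
  have fV: "\<And>x. x \<in> V \<Longrightarrow> f x \<in> V'" using f by (auto simp: bij_betw_def)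
  have ms: "mset_set V' = image_mset f (mset_set V)"
    using f by (simp add: bij_betw_def image_mset_mset_set)
  have fin': "finite V'" using f fin by (simp add: bij_betw_finite)
  have "image_mset g (mset_set V') = image_mset (\<lambda>x. x) (mset_set V)"
    unfolding ms multiset.map_comp using g(1) fin by (intro image_mset_cong) simp
  then have ms': "mset_set V = image_mset g (mset_set V')" by simp
  have "(\<Sum>\<kappa>\<in>colorings_of_type V' M. w' \<kappa>) = (\<Sum>\<kappa>\<in>colorings_of_type V M. w \<kappa>)"
  proof (rule sum.reindex_bij_witness[of _ "\<lambda>\<kappa>. restrict (\<kappa> \<circ> g) V'" "\<lambda>\<kappa>. restrict (\<kappa> \<circ> f) V"])
    fix a assume a: "a \<in> colorings_of_type V' M"
    then have aE: "a \<in> V' \<rightarrow>\<^sub>E UNIV" by (simp add: colorings_of_type_def)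
    show "restrict (restrict (a \<circ> f) V \<circ> g) V' = a"
      using aE g fV by (auto simp: fun_eq_iff restrict_def PiE_def extensional_def)
    show "restrict (a \<circ> f) V \<in> colorings_of_type V M"
      using a fin by (auto simp: colorings_of_type_def ms multiset.map_comp intro!: image_mset_cong)
    show "w (restrict (a \<circ> f) V) = w' a" using w[OF aE] by simp
  next
    fix a assume a: "a \<in> colorings_of_type V M"
    then have aE: "a \<in> V \<rightarrow>\<^sub>E UNIV" by (simp add: colorings_of_type_def)
    show "restrict (restrict (a \<circ> g) V' \<circ> f) V = a"
      using aE g fV by (auto simp: fun_eq_iff restrict_def PiE_def extensional_def)
    show "restrict (a \<circ> g) V' \<in> colorings_of_type V' M"
      using a fin' by (auto simp: colorings_of_type_def ms' multiset.map_comp intro!: image_mset_cong)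
  qed
  then show "pcoeff (color_series V' w') M = pcoeff (color_series V w) M"
    by (simp add: pcoeff_color_series)
qed

text \<open>A coloring of V1 \<union> V2 is a pair of colorings, and its monomial is the product of
  theirs. The assumptions on w1 and w2 express that each weight depends only on the colors of its
  own set.\<close>

lemma color_series_mult:
  assumes fin: "finite V1" "finite V2" and disj: "V1 \<inter> V2 = {}"
    and w1: "\<And>\<kappa>. w1 (restrict \<kappa> V1) = w1 \<kappa>" and w2: "\<And>\<kappa>. w2 (restrict \<kappa> V2) = w2 \<kappa>"
  shows "color_series V1 w1 * color_series V2 w2 = color_series (V1 \<union> V2) (\<lambda>\<kappa>. w1 \<kappa> * w2 \<kappa>)"
proof (rule pseries_eqI)
  fix M
  have ms: "mset_set (V1 \<union> V2) = mset_set V1 + mset_set V2"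
    using fin disj by (simp add: mset_set_Union)
  have img: "image_mset (\<lambda>x. if x \<in> V1 then a x else b x) (mset_set V1) = image_mset a (mset_set V1)"
    "image_mset (\<lambda>x. if x \<in> V1 then a x else b x) (mset_set V2) = image_mset b (mset_set V2)"
    "image_mset (restrict a V1) (mset_set V1) = image_mset a (mset_set V1)"
    "image_mset (restrict a V2) (mset_set V2) = image_mset a (mset_set V2)" for a b :: "'a \<Rightarrow> nat"
    using fin disj by (auto intro!: image_mset_cong)
  let ?D = "Sigma (splits M) (\<lambda>(A, B). colorings_of_type V1 A \<times> colorings_of_type V2 B)"
  have "pcoeff (color_series V1 w1 * color_series V2 w2) M =
    (\<Sum>x\<in>splits M. \<Sum>y\<in>colorings_of_type V1 (fst x) \<times> colorings_of_type V2 (snd x). w1 (fst y) * w2 (snd y))"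
    by (simp add: times_pseries.rep_eq pcoeff_color_series case_prod_unfold sum_product sum.cartesian_product)
  also have "\<dots> = (\<Sum>(x, y)\<in>?D. w1 (fst y) * w2 (snd y))"
    using fin by (subst sum.Sigma) (auto simp: case_prod_unfold)
  also have "\<dots> = (\<Sum>\<kappa>\<in>colorings_of_type (V1 \<union> V2) M. w1 \<kappa> * w2 \<kappa>)"
  \<comment> \<open>The splitting of M is recovered from a coloring as the pair of monomials of its
    restrictions.\<close>
  proof (rule sum.reindex_bij_witness[of _
        "\<lambda>\<kappa>. ((image_mset \<kappa> (mset_set V1), image_mset \<kappa> (mset_set V2)), (restrict \<kappa> V1, restrict \<kappa> V2))"
        "\<lambda>(x, (a, b)). \<lambda>x. if x \<in> V1 then a x else b x"], goal_cases)
    case (1 z)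
    then obtain A B a b where z: "z = ((A, B), (a, b))" "a \<in> V1 \<rightarrow>\<^sub>E UNIV" "b \<in> V2 \<rightarrow>\<^sub>E UNIV"
      "image_mset a (mset_set V1) = A" "image_mset b (mset_set V2) = B"
      by (auto simp: colorings_of_type_def)
    have "restrict (\<lambda>x. if x \<in> V1 then a x else b x) V1 = a"
      "restrict (\<lambda>x. if x \<in> V1 then a x else b x) V2 = b"
      using z(2,3) disj by (auto simp: fun_eq_iff restrict_def PiE_def extensional_def)
    then show ?case using z img by simp
  next
    case (2 z)
    then show ?case using disj img
      by (auto simp: colorings_of_type_def ms splits_def PiE_def extensional_def)
  next
    case (3 k)
    then show ?case by (auto simp: fun_eq_iff restrict_def colorings_of_type_def PiE_def extensional_def)
  next
    case (4 k)
    then show ?case using img by (auto simp: colorings_of_type_def ms splits_def)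
  next
    case (5 z)
    then obtain A B a b where z: "z = ((A, B), (a, b))" "a \<in> V1 \<rightarrow>\<^sub>E UNIV" "b \<in> V2 \<rightarrow>\<^sub>E UNIV"
      by (auto simp: colorings_of_type_def)
    have "restrict (\<lambda>x. if x \<in> V1 then a x else b x) V1 = a"
      "restrict (\<lambda>x. if x \<in> V1 then a x else b x) V2 = b"
      using z(2,3) disj by (auto simp: fun_eq_iff restrict_def PiE_def extensional_def)
    then show ?case using z(1) w1[of "\<lambda>x. if x \<in> V1 then a x else b x"]
        w2[of "\<lambda>x. if x \<in> V1 then a x else b x"] by simp
  qed
  finally show "pcoeff (color_series V1 w1 * color_series V2 w2) M =
      pcoeff (color_series (V1 \<union> V2) (\<lambda>\<kappa>. w1 \<kappa> * w2 \<kappa>)) M"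
    by (simp add: pcoeff_color_series)
qed

text \<open>The sum of all x_i^k, given by its coefficients. For k = 0 this is the series 1, so
  independence below concerns multisets without the part 0.\<close>

definition power_sum :: "nat \<Rightarrow> pseries" where
  "power_sum k = Abs_pseries (\<lambda>M. of_bool (\<exists>i. M = replicate_mset k i))"

definition monochromatic :: "'a set \<Rightarrow> ('a \<Rightarrow> nat) \<Rightarrow> rat" where
  "monochromatic K \<kappa> = of_bool (\<forall>u\<in>K. \<forall>v\<in>K. \<kappa> u = \<kappa> v)"

text \<open>A constant coloring is determined by its color i and has the monomial x_i^|K|, so each
  of these monomials arises exactly once.\<close>

lemma power_sum_eq_color_series:
  assumes "finite K" "K \<noteq> {}"
  shows "color_series K (monochromatic K) = power_sum (card K)"
proof (rule pseries_eqI)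
  fix M
  obtain x where x: "x \<in> K" using assms by auto
  let ?L = "{\<kappa> \<in> colorings_of_type K M. \<forall>u\<in>K. \<forall>v\<in>K. \<kappa> u = \<kappa> v}"
  have card: "card K > 0" using assms by (simp add: card_gt_0_iff)
  have const: "image_mset \<kappa> (mset_set K) = replicate_mset (card K) i"
    if "\<forall>u\<in>K. \<kappa> u = i" for \<kappa> :: "'a \<Rightarrow> nat" and i
  proof -
    have "image_mset \<kappa> (mset_set K) = image_mset (\<lambda>_. i) (mset_set K)"
      using that assms by (auto intro!: image_mset_cong)
    then show ?thesis by (simp add: image_mset_const_eq)
  qed
  have inj: "i = j" if "replicate_mset (card K) i = replicate_mset (card K) j" for i j :: nat
    using arg_cong[OF that, of set_mset] card by (simp split: if_splits)
  have eq: "card ?L = of_bool (\<exists>i. M = replicate_mset (card K) i)"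
  proof (cases "\<exists>i. M = replicate_mset (card K) i")
    case True
    then obtain i where i: "M = replicate_mset (card K) i" ..
    have "?L = {\<lambda>v\<in>K. i}"
    proof (rule equalityI; rule subsetI)
      fix \<kappa> assume k: "\<kappa> \<in> ?L"
      then have kx: "\<forall>u\<in>K. \<kappa> u = \<kappa> x" using x by blast
      have "\<kappa> x = i"
        using const[OF kx] k i by (intro inj) (simp add: colorings_of_type_def)
      with kx have "\<forall>u\<in>K. \<kappa> u = i" by simp
      with k show "\<kappa> \<in> {\<lambda>v\<in>K. i}"
        by (auto simp: colorings_of_type_def fun_eq_iff PiE_def extensional_def)
    next
      fix \<kappa> assume "\<kappa> \<in> {\<lambda>v\<in>K. i}"
      then show "\<kappa> \<in> ?L" using const[of "\<lambda>v\<in>K. i" i] i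
        by (simp add: colorings_of_type_def)
    qed
    with True show ?thesis by simp
  next
    case False
    have "?L = {}"
    proof (rule equals0I)
      fix \<kappa> assume k: "\<kappa> \<in> ?L"
      then have "\<forall>u\<in>K. \<kappa> u = \<kappa> x" using x by blast
      from const[OF this] k False show False by (metis (mono_tags, lifting) colorings_of_type_def mem_Collect_eq)
    qed
    with False show ?thesis by (simp only: card.empty) simp
  qed
  have "pcoeff (color_series K (monochromatic K)) M = of_nat (card ?L)"
    using assms by (simp add: pcoeff_color_series monochromatic_def Int_def flip: sum.inter_filter)
  also have "\<dots> = pcoeff (power_sum (card K)) M"
    unfolding eq by (simp add: power_sum_def Abs_pseries_inverse)
  finally show "pcoeff (color_series K (monochromatic K)) M = pcoeff (power_sum (card K)) M" .
qed

section \<open>Power sums and star products\<close>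

definition power_sum_prod :: "nat multiset \<Rightarrow> pseries" where
  "power_sum_prod p = (\<Prod>k\<in>#p. power_sum k)"

lemma power_sum_prod_simps [simp]:
  "power_sum_prod {#} = 1"
  "power_sum_prod (add_mset k p) = power_sum k * power_sum_prod p"
  "power_sum_prod (p + q) = power_sum_prod p * power_sum_prod q"
  by (simp_all add: power_sum_prod_def)

lemma star_prod_simps [simp]:
  "star_prod {#} = 1"
  "star_prod (add_mset k p) = star_sf k * star_prod p"
  "star_prod (p + q) = star_prod p * star_prod q"
  by (simp_all add: star_prod_def)

section \<open>Linear independence of products of power sums\<close>

lemma pcoeff_power_sum: "pcoeff (power_sum k) M = of_bool (\<exists>i. M = replicate_mset k i)"
  by (simp add: power_sum_def Abs_pseries_inverse)

lemma pcoeff_power_sum_prod_nonneg: "pcoeff (power_sum_prod p) M \<ge> 0"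
proof (induction p arbitrary: M)
  case empty
  then show ?case by (simp add: one_pseries.rep_eq)
next
  case (add k p)
  then show ?case
    by (auto simp: times_pseries.rep_eq pcoeff_power_sum intro!: sum_nonneg)
qed

text \<open>The partition that indexes the monomial symmetric function to which M belongs.\<close>

definition exponents :: "nat multiset \<Rightarrow> nat multiset" where
  "exponents M = image_mset (count M) (mset_set (set_mset M))"

lemma exponents_add_replicate:
  assumes "i \<notin># B" "k > 0"
  shows "exponents (replicate_mset k i + B) = add_mset k (exponents B)"
proof -
  have "set_mset (replicate_mset k i + B) = insert i (set_mset B)"
    using assms by auto
  moreover have "image_mset (count (replicate_mset k i + B)) (mset_set (set_mset B)) =
      image_mset (count B) (mset_set (set_mset B))"
    using assms by (intro image_mset_cong) auto
  ultimately show ?thesis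
    using assms by (simp add: exponents_def not_in_iff)
qed

text \<open>Each factor contributes a power of a single variable. If as many variables occur as
  there are factors, the factors use pairwise different variables, and the exponents are exactly the
  parts.\<close>

lemma pcoeff_power_sum_prod_nonzero:
  assumes "pcoeff (power_sum_prod p) M \<noteq> 0" "0 \<notin># p"
  shows "card (set_mset M) \<le> size p \<and> (card (set_mset M) = size p \<longrightarrow> exponents M = p)"
  using assms
proof (induction p arbitrary: M)
  case empty
  then show ?case by (simp add: one_pseries.rep_eq exponents_def split: if_splits)
next
  case (add k p)
  then obtain A B where AB: "A + B = M" "pcoeff (power_sum k) A * pcoeff (power_sum_prod p) B \<noteq> 0"
    by (force simp: times_pseries.rep_eq splits_def dest!: sum.not_neutral_contains_not_neutral)
  then obtain i where i: "A = replicate_mset k i" by (auto simp: pcoeff_power_sum)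
  have k: "k > 0" using add.prems by auto
  have IH: "card (set_mset B) \<le> size p" "card (set_mset B) = size p \<Longrightarrow> exponents B = p"
    using add.IH[of B] AB add.prems by auto
  have set: "set_mset M = insert i (set_mset B)" using AB i k by auto
  show ?case
  proof (cases "i \<in># B")
    case True
    then show ?thesis using set IH by (simp add: insert_absorb)
  next
    case False
    then show ?thesis using set IH exponents_add_replicate[OF False k] AB i by auto
  qed
qed

text \<open>A fresh variable is chosen for every part. All coefficients are nonnegative, so nothing
  cancels this contribution.\<close>

lemma ex_pcoeff_power_sum_prod:
  assumes "0 \<notin># p"
  shows "\<exists>M. card (set_mset M) = size p \<and> pcoeff (power_sum_prod p) M > 0"
  using assms
proof (induction p)
  case empty
  show ?case by (rule exI[of _ "{#}"]) (simp add: one_pseries.rep_eq)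
next
  case (add k p)
  then obtain B where B: "card (set_mset B) = size p" "pcoeff (power_sum_prod p) B > 0" by auto
  obtain i where i: "i \<notin># B"
    by (meson ex_new_if_finite finite_set_mset infinite_UNIV_nat)
  let ?M = "replicate_mset k i + B"
  have "pcoeff (power_sum_prod (add_mset k p)) ?M \<ge>
      (\<Sum>(A, B)\<in>{(replicate_mset k i, B)}. pcoeff (power_sum k) A * pcoeff (power_sum_prod p) B)"
    unfolding power_sum_prod_simps times_pseries.rep_eq
    by (rule sum_mono2[OF finite_splits]) (auto simp: splits_def pcoeff_power_sum pcoeff_power_sum_prod_nonneg)
  moreover have "(\<Sum>(A, B)\<in>{(replicate_mset k i, B)}. pcoeff (power_sum k) A * pcoeff (power_sum_prod p) B) > 0"
    using B by (auto simp: pcoeff_power_sum)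
  moreover have "set_mset ?M = insert i (set_mset B)" using add.prems by auto
  ultimately show ?case using B i by (intro exI[of _ ?M]) auto
qed

text \<open>Among the p with nonzero scalar, let q have the most parts, and let M be a monomial of
  its product with \<open>size q\<close> variables. Any other such p has too few parts to reach M,
  or has equally many and then a different exponent multiset, so the coefficient of M isolates the
  scalar of q.\<close>

lemma power_sum_prod_scalars_zero:
  assumes fin: "finite P" and P: "\<And>p. p \<in> P \<Longrightarrow> 0 \<notin># p"
    and zero: "(\<Sum>p\<in>P. scale_pseries (a p) (power_sum_prod p)) = 0" and p: "p \<in> P"
  shows "a p = 0"
proof (rule ccontr)
  assume ap: "a p \<noteq> 0"
  let ?N = "{p \<in> P. a p \<noteq> 0}"
  have "finite (size ` ?N)" "size ` ?N \<noteq> {}" using fin p ap by auto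
  then obtain q where q: "q \<in> ?N" "size q = Max (size ` ?N)"
    using Max_in by (metis (no_types, lifting) imageE)
  have qmax: "size p \<le> size q" if "p \<in> ?N" for p
    unfolding q(2) using that fin by (intro Max_ge) auto
  obtain M where M: "card (set_mset M) = size q" "pcoeff (power_sum_prod q) M > 0"
    using ex_pcoeff_power_sum_prod[of q] P q by auto
  have Mq: "exponents M = q"
    using pcoeff_power_sum_prod_nonzero[of q M] M P q by auto
  have "(\<Sum>p\<in>P. a p * pcoeff (power_sum_prod p) M) = (\<Sum>p\<in>{q}. a p * pcoeff (power_sum_prod p) M)"
  proof (rule sum.mono_neutral_right[OF fin])
    show "\<forall>p\<in>P - {q}. a p * pcoeff (power_sum_prod p) M = 0"
    proof (intro ballI, rule ccontr)
      fix p assume p: "p \<in> P - {q}" "a p * pcoeff (power_sum_prod p) M \<noteq> 0"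
      then have "size p \<le> size q" using qmax by auto
      with p pcoeff_power_sum_prod_nonzero[of p M] P M have "exponents M = p" by auto
      with Mq p show False by auto
    qed
  qed (use q in auto)
  moreover have "pcoeff (\<Sum>p\<in>P. scale_pseries (a p) (power_sum_prod p)) M = 0"
    using zero by (simp add: zero_pseries.rep_eq)
  ultimately show False using q M by (simp add: pcoeff_sum scale_pseries.rep_eq)
qed

lemma independent_power_sum_prod:
  assumes fin: "finite P" and P: "\<And>p. p \<in> P \<Longrightarrow> 0 \<notin># p"
  shows "inj_on power_sum_prod P" "pser.independent (power_sum_prod ` P)"
proof -
  show inj: "inj_on power_sum_prod P"
  proof (rule inj_onI, rule ccontr)
    fix p q assume pq: "p \<in> P" "q \<in> P" "power_sum_prod p = power_sum_prod q" "p \<noteq> q"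
    have *: "(\<Sum>r\<in>{p, q}. scale_pseries (if r = p then 1 else - 1) (power_sum_prod r)) = 0"
      using pq by simp
    have "(1::rat) = 0"
      using power_sum_prod_scalars_zero[OF _ _ *, of p] P pq by auto
    then show False by simp
  qed
  show "pser.independent (power_sum_prod ` P)"
  proof (rule pser.independent_if_scalars_zero)
    fix f x assume z: "(\<Sum>x\<in>power_sum_prod ` P. scale_pseries (f x) x) = 0" and "x \<in> power_sum_prod ` P"
    then obtain p where p: "p \<in> P" "x = power_sum_prod p" by auto
    from z have "(\<Sum>p\<in>P. scale_pseries (f (power_sum_prod p)) (power_sum_prod p)) = 0"
      by (simp add: sum.reindex[OF inj] o_def)
    from power_sum_prod_scalars_zero[OF fin P this p(1)] p(2) show "f x = 0" by simp
  qed (use fin in simp)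
qed

section \<open>Reading off hook coefficients from star expansions\<close>

definition all_ones :: "nat multiset \<Rightarrow> rat" where
  "all_ones p = of_bool (filter_mset (\<lambda>k. k \<noteq> 1) p = {#})"

text \<open>On partitions of n with 0 < h < n this is the indicator of the hook with large part h +
  1. Describing it by the parts different from 1 frees it from n, so that it can be applied to the
  factors of a product. For h = 0 it is constantly 0.\<close>

definition unique_large :: "nat \<Rightarrow> nat multiset \<Rightarrow> rat" where
  "unique_large h p = of_bool (filter_mset (\<lambda>k. k \<noteq> 1) p = {#Suc h#})"

lemma filter_hook: "filter_mset (\<lambda>j. j \<noteq> 1) (hook n m) = (if n - m = 1 then {#} else {#n - m#})"
proof -
  have "filter_mset (\<lambda>j. j \<noteq> 1) (replicate_mset m (1 :: nat)) = {#}"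
    by (induction m) simp_all
  then show ?thesis by (simp add: hook_def)
qed

lemma all_ones_hook: "all_ones (hook n m) = of_bool (n - m = 1)"
  unfolding all_ones_def filter_hook by simp

lemma unique_large_hook: "h > 0 \<Longrightarrow> unique_large h (hook n m) = of_bool (n - m = Suc h)"
  unfolding unique_large_def filter_hook by simp

lemma all_ones_add: "all_ones (p + q) = all_ones p * all_ones q"
  by (simp add: all_ones_def flip: of_bool_conj)

text \<open>Hook coefficients obey the Leibniz rule of a derivation along \<^const>\<open>all_ones\<close>.\<close>

lemma unique_large_add:
  "unique_large h (p + q) = all_ones p * unique_large h q + unique_large h p * all_ones q"
proof -
  have "of_bool (A + B = {#x#}) =
      of_bool (A = {#}) * of_bool (B = {#x#}) + of_bool (A = {#x#}) * (of_bool (B = {#}) :: rat)"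
    for A B :: "nat multiset" and x
    by (auto simp: union_is_single)
  then show ?thesis by (simp only: unique_large_def all_ones_def filter_union_mset)
qed

text \<open>Here x is the coefficient of (1^n) and, if 0 < h < n, y is that of the hook with large
  part h + 1. The expansion is existentially quantified, so sums and products can be formed before
  uniqueness is established.\<close>

definition star_rep :: "nat \<Rightarrow> nat \<Rightarrow> pseries \<Rightarrow> rat \<Rightarrow> rat \<Rightarrow> bool" where
  "star_rep h n X x y \<longleftrightarrow> (\<exists>a. X = (\<Sum>p\<in>partitions_of n. scale_pseries (a p) (star_prod p)) \<and>
    x = (\<Sum>p\<in>partitions_of n. a p * all_ones p) \<and> y = (\<Sum>p\<in>partitions_of n. a p * unique_large h p))"

lemma star_rep_star_prod:
  assumes "p \<in> partitions_of n"
  shows "star_rep h n (star_prod p) (all_ones p) (unique_large h p)"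
proof -
  have "(\<Sum>q\<in>partitions_of n. scale_pseries (of_bool (q = p)) (star_prod q)) =
      (\<Sum>q\<in>partitions_of n. if q = p then star_prod q else 0)"
    by (intro sum.cong) auto
  then show ?thesis using assms unfolding star_rep_def
    by (intro exI[of _ "\<lambda>q. of_bool (q = p)"]) (simp add: of_bool_def if_distrib[of "\<lambda>b. b * c" for c] cong: if_cong)
qed

lemma star_rep_sum:
  assumes "\<And>i. i \<in> I \<Longrightarrow> star_rep h n (X i) (x i) (y i)"
  shows "star_rep h n (\<Sum>i\<in>I. scale_pseries (c i) (X i)) (\<Sum>i\<in>I. c i * x i) (\<Sum>i\<in>I. c i * y i)"
proof -
  from assms have "\<exists>a. \<forall>i\<in>I. X i = (\<Sum>p\<in>partitions_of n. scale_pseries (a i p) (star_prod p)) \<and>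
      x i = (\<Sum>p\<in>partitions_of n. a i p * all_ones p) \<and> y i = (\<Sum>p\<in>partitions_of n. a i p * unique_large h p)"
    unfolding star_rep_def by metis
  then obtain a where a: "\<And>i. i \<in> I \<Longrightarrow> X i = (\<Sum>p\<in>partitions_of n. scale_pseries (a i p) (star_prod p))"
    "\<And>i. i \<in> I \<Longrightarrow> x i = (\<Sum>p\<in>partitions_of n. a i p * all_ones p)"
    "\<And>i. i \<in> I \<Longrightarrow> y i = (\<Sum>p\<in>partitions_of n. a i p * unique_large h p)"
    by blast
  have 1: "(\<Sum>i\<in>I. scale_pseries (c i) (X i)) =
      (\<Sum>p\<in>partitions_of n. scale_pseries (\<Sum>i\<in>I. c i * a i p) (star_prod p))"
    by (simp add: a(1) pser.scale_sum_right pser.scale_sum_left) (rule sum.swap)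
  have 2: "(\<Sum>i\<in>I. c i * x i) = (\<Sum>p\<in>partitions_of n. (\<Sum>i\<in>I. c i * a i p) * all_ones p)"
    by (simp add: a(2) sum_distrib_left sum_distrib_right mult.assoc) (rule sum.swap)
  have 3: "(\<Sum>i\<in>I. c i * y i) = (\<Sum>p\<in>partitions_of n. (\<Sum>i\<in>I. c i * a i p) * unique_large h p)"
    by (simp add: a(3) sum_distrib_left sum_distrib_right mult.assoc) (rule sum.swap)
  show ?thesis unfolding star_rep_def
    by (rule exI[of _ "\<lambda>p. \<Sum>i\<in>I. c i * a i p"]) (intro conjI 1 2 3)
qed

text \<open>The pairs (x, y) multiply like dual numbers x + y eps; this is why x is carried
  along.\<close>

lemma star_rep_mult:
  assumes "star_rep h m X x y" "star_rep h n Y x' y'"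
  shows "star_rep h (m + n) (X * Y) (x * x') (x * y' + y * x')"
proof -
  obtain a where X: "X = (\<Sum>p\<in>partitions_of m. scale_pseries (a p) (star_prod p))"
    "x = (\<Sum>p\<in>partitions_of m. a p * all_ones p)" "y = (\<Sum>p\<in>partitions_of m. a p * unique_large h p)"
    using assms(1) unfolding star_rep_def by blast
  obtain b where Y: "Y = (\<Sum>p\<in>partitions_of n. scale_pseries (b p) (star_prod p))"
    "x' = (\<Sum>p\<in>partitions_of n. b p * all_ones p)" "y' = (\<Sum>p\<in>partitions_of n. b p * unique_large h p)"
    using assms(2) unfolding star_rep_def by blast
  let ?I = "partitions_of m \<times> partitions_of n"
  have "star_rep h (m + n) (\<Sum>i\<in>?I. scale_pseries (a (fst i) * b (snd i)) (star_prod (fst i + snd i)))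
      (\<Sum>i\<in>?I. (a (fst i) * b (snd i)) * all_ones (fst i + snd i))
      (\<Sum>i\<in>?I. (a (fst i) * b (snd i)) * unique_large h (fst i + snd i))"
    by (intro star_rep_sum star_rep_star_prod) (auto simp: partitions_of_def)
  moreover have "(\<Sum>i\<in>?I. scale_pseries (a (fst i) * b (snd i)) (star_prod (fst i + snd i))) = X * Y"
    by (simp add: X Y sum_product sum.cartesian_product case_prod_unfold scale_mult_scale)
  moreover have "(\<Sum>i\<in>?I. (a (fst i) * b (snd i)) * all_ones (fst i + snd i)) = x * x'"
    by (simp add: X Y sum_product sum.cartesian_product case_prod_unfold all_ones_add ac_simps)
  moreover have "(\<Sum>i\<in>?I. (a (fst i) * b (snd i)) * unique_large h (fst i + snd i)) = x * y' + y * x'"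
    unfolding X Y sum_product sum.cartesian_product case_prod_unfold sum.distrib[symmetric]
    by (intro sum.cong) (simp_all add: unique_large_add algebra_simps)
  ultimately show ?thesis by simp
qed

section \<open>Star expansions of power sums\<close>

lemma color_series_one:
  assumes "finite W"
  shows "color_series W (\<lambda>_. 1) = star_sf 1 ^ card W"
  using assms
proof (induction W)
  case empty
  have "color_series {} (\<lambda>_. 1) = (1 :: pseries)"
    by (rule pseries_eqI) (auto simp: pcoeff_color_series colorings_of_type_def one_pseries.rep_eq)
  then show ?case by simp
next
  case (insert v W)
  have "star_sf 1 = color_series {0..<1::nat} (\<lambda>_. 1)"
    unfolding star_sf_def chromatic_sf_eq_color_series[OF finite_atLeastLessThan]
    by (rule color_series_cong) simp
  also have "\<dots> = color_series {v} (\<lambda>_. 1)"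
    by (rule color_series_bij[where f = "\<lambda>_. 0"]) (auto simp: bij_betw_def)
  finally have s: "star_sf 1 = color_series {v} (\<lambda>_. 1)" .
  have "color_series {v} (\<lambda>_. 1) * color_series W (\<lambda>_. 1) = color_series ({v} \<union> W) (\<lambda>\<kappa>. 1 * 1)"
    by (rule color_series_mult) (use insert in auto)
  then show ?case using insert s by simp
qed

text \<open>Frees the star from its standard vertices, so that any subset J of the leaves can be
  used in the expansion of a power sum.\<close>

lemma color_series_star:
  assumes "finite J" "v \<notin> J"
  shows "color_series (insert v J) (\<lambda>\<kappa>. of_bool (\<forall>j\<in>J. \<kappa> j \<noteq> \<kappa> v)) = star_sf (Suc (card J))"
proof -
  obtain f where f: "bij_betw f J {1..<Suc (card J)}"
    using ex_bij_betw_finite_nat[OF assms(1)] finite_same_card_bij[OF assms(1), of "{1..<Suc (card J)}"] by auto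
  define g where "g = f(v := 0)"
  have g: "bij_betw g (insert v J) {0..<Suc (card J)}"
  proof -
    have "g ` J = f ` J" using assms by (auto simp: g_def)
    moreover have "inj_on g J" using f assms by (auto simp: g_def bij_betw_def inj_on_def)
    ultimately show ?thesis using f assms by (auto simp: bij_betw_def g_def)
  qed
  have gJ: "g ` J = {1..<Suc (card J)}" using f assms by (auto simp: g_def bij_betw_def)
  let ?w = "\<lambda>\<kappa>. of_bool (\<forall>u w. {u, w} \<in> {{0, i} |i. 1 \<le> i \<and> i < Suc (card J)} \<longrightarrow> \<kappa> u \<noteq> \<kappa> w) :: rat"
  have "?w \<kappa> = of_bool (\<forall>j\<in>J. restrict (\<kappa> \<circ> g) (insert v J) j \<noteq> restrict (\<kappa> \<circ> g) (insert v J) v)"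
    for \<kappa> :: "nat \<Rightarrow> nat"
  proof -
    have "(\<forall>u w. {u, w} \<in> {{0, i} |i. 1 \<le> i \<and> i < Suc (card J)} \<longrightarrow> \<kappa> u \<noteq> \<kappa> w) \<longleftrightarrow>
        (\<forall>i\<in>{1..<Suc (card J)}. \<kappa> i \<noteq> \<kappa> 0)" (is "?A \<longleftrightarrow> ?B")
    proof
      assume ?A
      then show ?B by (force simp: insert_commute)
    next
      assume ?B
      then show ?A by (auto simp: doubleton_eq_iff)
    qed
    also have "\<dots> \<longleftrightarrow> (\<forall>j\<in>J. restrict (\<kappa> \<circ> g) (insert v J) j \<noteq> restrict (\<kappa> \<circ> g) (insert v J) v)"
      unfolding gJ[symmetric] by (auto simp: g_def)
    finally show ?thesis by simp
  qed
  then have "color_series {0..<Suc (card J)} ?w =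
      color_series (insert v J) (\<lambda>\<kappa>. of_bool (\<forall>j\<in>J. \<kappa> j \<noteq> \<kappa> v))"
    using assms by (intro color_series_bij[OF _ g]) simp_all
  then show ?thesis
    unfolding star_sf_def chromatic_sf_eq_color_series[OF finite_atLeastLessThan] by simp
qed

text \<open>Inclusion-exclusion over the set of leaves whose color differs from that of the center.\<close>

lemma power_sum_star_rep:
  assumes "k > 0" "h > 0"
  shows "star_rep h k (power_sum k) 1 ((-1) ^ h * of_nat ((k - 1) choose h))"
proof -
  let ?L = "{1..<k}"
  have L: "insert 0 ?L = {0..<k}" using assms by auto
  have prod: "monochromatic {0..<k} \<kappa> = (\<Sum>J\<in>Pow ?L. (- 1) ^ card J * of_bool (\<forall>j\<in>J. \<kappa> j \<noteq> \<kappa> 0))" for \<kappa>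
  proof -
    have "monochromatic {0..<k} \<kappa> = (\<Prod>j\<in>?L. 1 - of_bool (\<kappa> j \<noteq> \<kappa> 0))"
    proof (cases "\<forall>j\<in>?L. \<kappa> j = \<kappa> 0")
      case True
      then show ?thesis unfolding monochromatic_def L[symmetric] by auto
    next
      case False
      then obtain j where j: "j \<in> ?L" "\<kappa> j \<noteq> \<kappa> 0" by blast
      then have p0: "(\<Prod>j\<in>?L. 1 - of_bool (\<kappa> j \<noteq> \<kappa> 0)) = (0 :: rat)"
        by (intro prod_zero) auto
      have "j \<in> {0..<k}" "0 \<in> {0..<k}" using j by auto
      then have "monochromatic {0..<k} \<kappa> = 0"
        unfolding monochromatic_def of_bool_eq_0_iff using j(2) by blast
      then show ?thesis using p0 by simp
    qed
    also have "\<dots> = (\<Sum>J\<in>Pow ?L. (- 1) ^ card J * (\<Prod>j\<in>J. of_bool (\<kappa> j \<noteq> \<kappa> 0)))"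
      by (subst prod_diff_conv_sum) simp_all
    also have "\<dots> = (\<Sum>J\<in>Pow ?L. (- 1) ^ card J * of_bool (\<forall>j\<in>J. \<kappa> j \<noteq> \<kappa> 0))"
    proof (rule sum.cong[OF refl])
      fix J assume "J \<in> Pow ?L"
      then have "finite J" using finite_subset by auto
      then have "(\<Prod>j\<in>J. of_bool (\<kappa> j \<noteq> \<kappa> 0)) = (of_bool (\<forall>j\<in>J. \<kappa> j \<noteq> \<kappa> 0) :: rat)"
        by (induction J) auto
      then show "(- 1) ^ card J * (\<Prod>j\<in>J. of_bool (\<kappa> j \<noteq> \<kappa> 0)) =
          (- 1) ^ card J * (of_bool (\<forall>j\<in>J. \<kappa> j \<noteq> \<kappa> 0) :: rat)" by simp
    qed
    finally show ?thesis .
  qed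
  have part: "hook k (k - 1 - card J) \<in> partitions_of k" "card J \<le> k - 1"
    "k - (k - 1 - card J) = Suc (card J)" if "J \<in> Pow ?L" for J
  proof -
    have "card J \<le> card ?L" using that by (intro card_mono) auto
    then show "card J \<le> k - 1" by simp
    then show "k - (k - 1 - card J) = Suc (card J)" using assms by simp
    with assms show "hook k (k - 1 - card J) \<in> partitions_of k"
      by (auto simp: hook_def partitions_of_def sum_mset_replicate_mset in_replicate_mset)
  qed
  \<comment> \<open>The center 0 and the leaves in J form a star; the remaining leaves are
    unconstrained and give the parts 1.\<close>
  have series: "color_series {0..<k} (\<lambda>\<kappa>. of_bool (\<forall>j\<in>J. \<kappa> j \<noteq> \<kappa> 0)) = star_prod (hook k (k - 1 - card J))"
    if J: "J \<in> Pow ?L" for J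
  proof -
    have fJ: "finite J" "0 \<notin> J" using J finite_subset by auto
    have ins: "insert 0 J \<union> (?L - J) = {0..<k}" using J L by auto
    have "star_sf (Suc (card J)) * star_sf 1 ^ card (?L - J) =
        color_series (insert 0 J \<union> (?L - J)) (\<lambda>\<kappa>. of_bool (\<forall>j\<in>J. \<kappa> j \<noteq> \<kappa> 0) * 1)"
      unfolding color_series_star[OF fJ, symmetric]
      by (subst color_series_one[symmetric], simp, rule color_series_mult) (use fJ in auto)
    also have "card (?L - J) = k - 1 - card J"
      using J by (simp add: card_Diff_subset fJ)
    finally show ?thesis using part[OF J] unfolding ins
      by (simp add: hook_def star_prod_def)
  qed
  have "power_sum k = color_series {0..<k} (monochromatic {0..<k})"
    using power_sum_eq_color_series[of "{0..<k}"] assms by simp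
  also have "\<dots> = (\<Sum>J\<in>Pow ?L. scale_pseries ((- 1) ^ card J) (star_prod (hook k (k - 1 - card J))))"
    unfolding prod[abs_def] color_series_sum by (intro sum.cong refl arg_cong[of _ _ "scale_pseries c" for c] series)
  finally have ps: "power_sum k = \<dots>" .
  have "star_rep h k (power_sum k)
      (\<Sum>J\<in>Pow ?L. (- 1) ^ card J * all_ones (hook k (k - 1 - card J)))
      (\<Sum>J\<in>Pow ?L. (- 1) ^ card J * unique_large h (hook k (k - 1 - card J)))"
    unfolding ps by (intro star_rep_sum star_rep_star_prod part)
  \<comment> \<open>Only J = {} gives the partition (1^k), and below only |J| = h gives the large
    part h + 1.\<close>
  moreover have "(\<Sum>J\<in>Pow ?L. (- 1) ^ card J * all_ones (hook k (k - 1 - card J))) = 1"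
  proof -
    have "(\<Sum>J\<in>Pow ?L. (- 1) ^ card J * all_ones (hook k (k - 1 - card J))) = (\<Sum>J\<in>Pow ?L. of_bool (J = {}))"
    proof (rule sum.cong[OF refl])
      fix J assume J: "J \<in> Pow ?L"
      then have "finite J" using finite_subset by auto
      then show "(- 1) ^ card J * all_ones (hook k (k - 1 - card J)) = (of_bool (J = {}) :: rat)"
        using part(3)[OF J] by (auto simp: all_ones_hook)
    qed
    then show ?thesis by (simp add: of_bool_def)
  qed
  moreover have "(\<Sum>J\<in>Pow ?L. (- 1) ^ card J * unique_large h (hook k (k - 1 - card J))) =
      (-1) ^ h * of_nat ((k - 1) choose h)"
  proof -
    have "(\<Sum>J\<in>Pow ?L. (- 1) ^ card J * unique_large h (hook k (k - 1 - card J))) =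
        (\<Sum>J\<in>Pow ?L. if card J = h then (- 1) ^ h else 0)"
    proof (rule sum.cong[OF refl])
      fix J assume J: "J \<in> Pow ?L"
      show "(- 1) ^ card J * unique_large h (hook k (k - 1 - card J)) = (if card J = h then (- 1) ^ h else (0 :: rat))"
        using part(3)[OF J] assms(2) by (simp add: unique_large_hook)
    qed
    also have "\<dots> = of_nat (card {J \<in> Pow ?L. card J = h}) * (- 1) ^ h"
      by (simp flip: sum.inter_filter)
    also have "card {J \<in> Pow ?L. card J = h} = (k - 1) choose h"
      using n_subsets[of ?L h] by (simp add: Pow_def)
    finally show ?thesis by simp
  qed
  ultimately show ?thesis by simp
qed

text \<open>Every factor has x = 1, so the product rule makes y additive over the parts.\<close>

lemma power_sum_prod_star_rep:
  assumes "h > 0" "0 \<notin># p"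
  shows "star_rep h (sum_mset p) (power_sum_prod p) 1
    (\<Sum>k\<in>#p. (-1) ^ h * of_nat ((k - 1) choose h))"
  using assms(2)
proof (induction p)
  case empty
  have "partitions_of 0 = {{#}}"
    by (auto simp: partitions_of_def sum_mset_0_iff) (metis multiset_nonemptyE)
  then show ?case by (simp add: star_rep_def all_ones_def unique_large_def exI[of _ "\<lambda>_. 1"])
next
  case (add k p)
  then have "star_rep h (sum_mset p) (power_sum_prod p) 1 (\<Sum>k\<in>#p. (-1) ^ h * of_nat ((k - 1) choose h))"
    by simp
  from star_rep_mult[OF power_sum_star_rep[of k h] this] add.prems assms(1) show ?case
    by (simp add: add.commute)
qed

text \<open>Two different expansions give a nontrivial relation, which expresses one star product by
  the others. The remaining ones would then span all \<open>power_sum_prod p\<close>, which are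
  independent and outnumber them.\<close>

lemma star_expansion_unique:
  assumes "is_star_expansion n X a" "is_star_expansion n X b"
  shows "a = b"
proof (rule ccontr)
  assume "a \<noteq> b"
  then obtain q where q: "a q \<noteq> b q" by auto
  let ?P = "partitions_of n"
  have qP: "q \<in> ?P" using q assms unfolding is_star_expansion_def by metis
  define d where "d p = a p - b p" for p
  have dq: "d q \<noteq> 0" using q by (simp add: d_def)
  have "(\<Sum>p\<in>?P. scale_pseries (d p) (star_prod p)) = 0"
    using assms unfolding is_star_expansion_def d_def by (simp add: pser.scale_left_diff_distrib sum_subtractf)
  then have "scale_pseries (d q) (star_prod q) = - (\<Sum>p\<in>?P - {q}. scale_pseries (d p) (star_prod p))"
    using qP by (simp add: sum.remove eq_neg_iff_add_eq_0)
  then have "scale_pseries (inverse (d q)) (scale_pseries (d q) (star_prod q)) =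
      scale_pseries (inverse (d q)) (- (\<Sum>p\<in>?P - {q}. scale_pseries (d p) (star_prod p)))" by simp
  then have sq: "star_prod q = scale_pseries (inverse (d q)) (- (\<Sum>p\<in>?P - {q}. scale_pseries (d p) (star_prod p)))"
    using dq by simp
  let ?T = "star_prod ` (?P - {q})"
  have "star_prod q \<in> pser.span ?T" unfolding sq
    by (intro pser.span_scale pser.span_neg pser.span_sum pser.span_base) auto
  then have all: "star_prod p \<in> pser.span ?T" if "p \<in> ?P" for p
    using that by (cases "p = q") (auto intro: pser.span_base)
  have sub: "power_sum_prod ` ?P \<subseteq> pser.span ?T"
  proof
    fix f assume "f \<in> power_sum_prod ` ?P"
    then obtain p where p: "p \<in> ?P" "f = power_sum_prod p" by auto
    \<comment> \<open>Only the expansion inside \<open>star_rep\<close> is wanted, so any positive h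
      serves.\<close>
    then obtain a where "f = (\<Sum>p\<in>?P. scale_pseries (a p) (star_prod p))"
      using power_sum_prod_star_rep[of 1 p] by (auto simp: star_rep_def partitions_of_def)
    then show "f \<in> pser.span ?T" by (auto intro!: pser.span_sum pser.span_scale all)
  qed
  have nz: "\<And>p. p \<in> ?P \<Longrightarrow> 0 \<notin># p" by (simp add: partitions_of_def)
  have "card (power_sum_prod ` ?P) \<le> card ?T"
    using pser.independent_span_bound[OF _ independent_power_sum_prod(2)[OF finite_partitions_of nz] sub] by simp
  also have "\<dots> \<le> card (?P - {q})" by (rule card_image_le) simp
  also have "\<dots> < card ?P" using qP by (intro psubset_card_mono) auto
  finally show False
    using card_image[OF independent_power_sum_prod(1)[OF finite_partitions_of nz]] by simp
qed

lemma star_coeff_hook: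
  assumes rep: "star_rep h n X x y" and h: "h > 0" "h < n"
  shows "star_coeff n X (hook n (n - 1 - h)) = y"
proof -
  obtain a where X: "X = (\<Sum>p\<in>partitions_of n. scale_pseries (a p) (star_prod p))"
    and y: "y = (\<Sum>p\<in>partitions_of n. a p * unique_large h p)"
    using rep unfolding star_rep_def by blast
  \<comment> \<open>\<open>is_star_expansion\<close> prescribes the value 0 outside the partitions
    of n.\<close>
  define b where "b p = (if p \<in> partitions_of n then a p else 0)" for p
  have b: "is_star_expansion n X b"
    unfolding is_star_expansion_def X b_def by auto
  have hk: "n - (n - 1 - h) = Suc h" using h by simp
  have in_P: "hook n (n - 1 - h) \<in> partitions_of n"
    using h by (auto simp: hook_def partitions_of_def in_replicate_mset)
  \<comment> \<open>The total n fixes the number of parts 1, so a partition of n is determined by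
    its other parts.\<close>
  have "unique_large h p = of_bool (p = hook n (n - 1 - h))" if p: "p \<in> partitions_of n" for p
  proof -
    have split: "p = filter_mset (\<lambda>k. k \<noteq> 1) p + replicate_mset (count p 1) 1"
      by (rule multiset_eqI) auto
    have 1: "p = hook n (n - 1 - h)" if f: "filter_mset (\<lambda>k. k \<noteq> 1) p = {#Suc h#}"
    proof -
      have p': "p = add_mset (Suc h) (replicate_mset (count p 1) 1)"
        using arg_cong2[OF f refl, of "(+)" "replicate_mset (count p 1) 1"] split by simp
      then obtain m where m: "p = add_mset (Suc h) (replicate_mset m 1)" by blast
      then have "Suc h + m = n" using p by (simp add: partitions_of_def sum_mset_replicate_mset)
      then have "m = n - 1 - h" by simp
      with m show ?thesis unfolding hook_def hk by simp
    qed
    have 2: "filter_mset (\<lambda>k. k \<noteq> 1) (hook n (n - 1 - h)) = {#Suc h#}"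
      unfolding filter_hook hk using h by simp
    have "filter_mset (\<lambda>k. k \<noteq> 1) p = {#Suc h#} \<longleftrightarrow> p = hook n (n - 1 - h)"
      using 1 by (rule iffI) (assumption, simp only: 2)
    then show ?thesis by (simp only: unique_large_def)
  qed
  then have "y = (\<Sum>p\<in>partitions_of n. if p = hook n (n - 1 - h) then a p else 0)"
    unfolding y by (intro sum.cong) auto
  then have "y = b (hook n (n - 1 - h))" using in_P by (simp add: b_def)
  moreover have "star_coeff n X = b"
    unfolding star_coeff_def using b star_expansion_unique[OF _ b] by (rule the_equality)
  ultimately show ?thesis by simp
qed

section \<open>Connected spanning edge sets of cycles\<close>

lemma sym_adj_rtrancl: "(x, y) \<in> (adj E)\<^sup>* \<longleftrightarrow> (y, x) \<in> (adj E)\<^sup>*"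
proof -
  have "sym (adj E)" by (auto simp: adj_def sym_def insert_commute)
  then show ?thesis using sym_rtrancl by (metis symE)
qed

lemma adj_rtrancl_mono: "(x, y) \<in> (adj S)\<^sup>* \<Longrightarrow> S \<subseteq> T \<Longrightarrow> (x, y) \<in> (adj T)\<^sup>*"
  by (rule subsetD[OF rtrancl_mono]) (auto simp: adj_def)

lemma adj_rtrancl_edge: "{x, y} \<in> E \<Longrightarrow> (x, y) \<in> (adj E)\<^sup>*"
  by (simp add: adj_def r_into_rtrancl)

lemma adj_rtrancl_closed:
  assumes "(x, y) \<in> (adj S)\<^sup>*" "x \<in> X" "\<And>e. e \<in> S \<Longrightarrow> e \<subseteq> X \<or> e \<inter> X = {}"
  shows "y \<in> X"
  using assms(1,2)
proof (induction rule: rtrancl_induct)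
  case (step y z)
  then have "{y, z} \<in> S" "y \<in> X" by (auto simp: adj_def)
  with assms(3)[of "{y, z}"] show ?case by auto
qed

text \<open>Serves to refute connectivity by a vertex set X that no edge crosses, and conversely to
  find an edge that leaves a given set.\<close>

lemma connected_graph_closed:
  assumes "connected_graph K S" "x \<in> K" "x \<in> X" "y \<in> K" "\<And>e. e \<in> S \<Longrightarrow> e \<subseteq> X \<or> e \<inter> X = {}"
  shows "y \<in> X"
  using assms adj_rtrancl_closed[of x y S X] unfolding connected_graph_def by blast

lemma connected_graphI:
  assumes "x \<in> K" "\<And>y. y \<in> K \<Longrightarrow> (x, y) \<in> (adj S)\<^sup>*"
  shows "connected_graph K S"
  unfolding connected_graph_def using assms sym_adj_rtrancl rtrancl_trans by (metis empty_iff)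

lemma connected_graph_pendant:
  assumes v: "v \<notin> K" "v \<notin> \<Union>S" and w: "w \<in> K"
  shows "connected_graph (insert v K) (insert {v, w} S) \<longleftrightarrow> connected_graph K S"
proof
  assume c: "connected_graph (insert v K) (insert {v, w} S)"
  \<comment> \<open>Contracting the pendant edge onto w maps walks to walks.\<close>
  define f where "f x = (if x = v then w else x)" for x
  have f: "(f x, f y) \<in> (adj S)\<^sup>*" if "(x, y) \<in> (adj (insert {v, w} S))\<^sup>*" for x y
    using that
  proof (induction rule: rtrancl_induct)
    case (step y z)
    then have "{y, z} = {v, w} \<or> {y, z} \<in> S" by (auto simp: adj_def)
    then have "(f y, f z) \<in> (adj S)\<^sup>*"
    proof
      assume "{y, z} = {v, w}"
      then show ?thesis using v w by (auto simp: f_def doubleton_eq_iff)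
    next
      assume s: "{y, z} \<in> S"
      then have "y \<noteq> v" "z \<noteq> v" using v by auto
      then show ?thesis using s by (simp add: f_def adj_rtrancl_edge)
    qed
    with step show ?case by simp
  qed simp
  show "connected_graph K S"
  proof (rule connected_graphI[OF w])
    fix y assume y: "y \<in> K"
    then have "(w, y) \<in> (adj (insert {v, w} S))\<^sup>*"
      using c w by (simp add: connected_graph_def)
    from f[OF this] show "(w, y) \<in> (adj S)\<^sup>*" using v y w by (auto simp: f_def split: if_splits)
  qed
next
  assume c: "connected_graph K S"
  show "connected_graph (insert v K) (insert {v, w} S)"
  proof (rule connected_graphI[of w])
    fix y assume "y \<in> insert v K"
    then show "(w, y) \<in> (adj (insert {v, w} S))\<^sup>*"
    proof
      assume "y = v"
      then show ?thesis by (auto intro!: adj_rtrancl_edge)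
    next
      assume "y \<in> K"
      then have "(w, y) \<in> (adj S)\<^sup>*" using c w by (simp add: connected_graph_def)
      then show ?thesis by (rule adj_rtrancl_mono) auto
    qed
  qed (use w in simp)
qed

text \<open>For a simple graph this is the coefficient of q in the chromatic polynomial of the
  induced graph on K.\<close>

definition connected_sum :: "'a set set \<Rightarrow> 'a set \<Rightarrow> rat" where
  "connected_sum E K = (\<Sum>S | S \<subseteq> E \<and> \<Union>S \<subseteq> K \<and> connected_graph K S. (-1) ^ card S)"

text \<open>The quantity a(K) of the overview: K meets every edge exactly when its complement is
  independent.\<close>

definition cover_sum :: "'a set set \<Rightarrow> 'a set \<Rightarrow> rat" where
  "cover_sum E K = (if \<forall>e\<in>E. e \<inter> K \<noteq> {} then connected_sum E K else 0)"

text \<open>Without the edge {v, w} the vertex v would be isolated, so every connected S contains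
  it. Removing it is a bijection that flips the sign.\<close>

lemma connected_sum_pendant:
  assumes E: "finite E" and v: "v \<notin> K" "v \<notin> \<Union>E" and w: "w \<in> K"
  shows "connected_sum (insert {v, w} E) (insert v K) = - connected_sum E K"
proof -
  have nE: "{v, w} \<notin> E" using v by auto
  let ?A = "{S. S \<subseteq> E \<and> \<Union>S \<subseteq> K \<and> connected_graph K S}"
  have "{S. S \<subseteq> insert {v, w} E \<and> \<Union>S \<subseteq> insert v K \<and> connected_graph (insert v K) S} =
      insert {v, w} ` ?A" (is "?B = _")
  proof (intro equalityI subsetI)
    fix S assume S: "S \<in> ?B"
    have vw: "{v, w} \<in> S"
    proof (rule ccontr)
      assume "{v, w} \<notin> S"
      then have "e \<subseteq> {v} \<or> e \<inter> {v} = {}" if "e \<in> S" for e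
        using S that v by auto
      then have "w \<in> {v}"
        using connected_graph_closed[of "insert v K" S v "{v}" w] S w by blast
      then show False using v w by auto
    qed
    let ?S = "S - {{v, w}}"
    have S': "S = insert {v, w} ?S" "?S \<subseteq> E" "v \<notin> \<Union>?S" using S vw v by auto
    have "connected_graph (insert v K) (insert {v, w} ?S)" using S S'(1) by auto
    then have "connected_graph K ?S" using connected_graph_pendant[OF v(1) S'(3) w] by simp
    moreover have "\<Union>?S \<subseteq> K" using S S'(3) by auto
    ultimately show "S \<in> insert {v, w} ` ?A" using S' by (intro image_eqI[of _ _ ?S]) auto
  next
    fix S assume "S \<in> insert {v, w} ` ?A"
    then obtain T where T: "S = insert {v, w} T" "T \<in> ?A" by auto
    then have "v \<notin> \<Union>T" using v by auto
    then show "S \<in> ?B" using T w connected_graph_pendant[OF v(1) _ w, of T] by auto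
  qed
  moreover have "inj_on (insert {v, w}) ?A"
  proof (rule inj_onI)
    fix S T assume "S \<in> ?A" "T \<in> ?A" "insert {v, w} S = insert {v, w} T"
    moreover from this have "{v, w} \<notin> S" "{v, w} \<notin> T" using nE by auto
    ultimately show "S = T" by (simp add: insert_ident)
  qed
  moreover have "card (insert {v, w} S) = Suc (card S)" if "S \<in> ?A" for S
    using that nE finite_subset[OF _ E, of S] by (auto intro!: card_insert_disjoint)
  ultimately show ?thesis
    by (simp add: connected_sum_def sum.reindex sum_negf)
qed

section \<open>The cycle as a cyclic list of vertices\<close>

definition cycle_edge :: "'a list \<Rightarrow> nat \<Rightarrow> 'a set" where
  "cycle_edge vs i = {vs ! i, vs ! (Suc i mod length vs)}"

text \<open>Spelled as in \<open>is_cycle\<close>, so that unfolding identifies the two;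
  \<open>cycle_edge\<close> supplies a numbering of the same edges.\<close>

definition cycle_edges :: "'a list \<Rightarrow> 'a set set" where
  "cycle_edges vs = {{vs ! i, vs ! (Suc i mod length vs)} | i. i < length vs}"

lemma cycle_edges_image: "cycle_edges vs = cycle_edge vs ` {..<length vs}"
  by (auto simp: cycle_edges_def cycle_edge_def)

locale cycle_list =
  fixes vs :: "'a list"
  assumes distinct: "distinct vs" and length: "length vs \<ge> 3"
begin

abbreviation c where "c \<equiv> length vs"

lemma nth_eq [simp]: "i < c \<Longrightarrow> j < c \<Longrightarrow> vs ! i = vs ! j \<longleftrightarrow> i = j"
  using distinct by (simp add: nth_eq_iff_index_eq)

lemma mod_Suc': "i < c \<Longrightarrow> Suc i mod c = (if Suc i = c then 0 else Suc i)"
  by (auto simp: mod_Suc)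

lemma mod_Suc_less [simp]: "Suc i mod c < c"
  using length by (intro mod_less_divisor) auto

lemma not_Nil [simp]: "vs \<noteq> []"
  using length by auto

lemma nth_Suc_mod_neq: "i < c \<Longrightarrow> vs ! (Suc i mod c) \<noteq> vs ! i"
  using length by (auto simp: mod_Suc')

text \<open>The inverse of the cyclic successor. Edge i leads from position i to its successor, so
  the edges at position a are those numbered a and \<open>prev a\<close>.\<close>

definition prev where "prev i = (if i = 0 then c - 1 else i - 1)"

lemma prev: "i < c \<Longrightarrow> prev i < c" "i < c \<Longrightarrow> Suc (prev i) mod c = i" "i < c \<Longrightarrow> prev i \<noteq> i"
  using length by (auto simp: prev_def)

lemma Suc_mod_eq_iff: "i < c \<Longrightarrow> j < c \<Longrightarrow> Suc i mod c = j \<longleftrightarrow> i = prev j"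
  using length by (auto simp: prev_def mod_Suc')

lemma cycle_edge_subset: "i < c \<Longrightarrow> cycle_edge vs i \<subseteq> set vs"
  using length by (auto simp: cycle_edge_def)

lemma nth_in_cycle_edge: "a < c \<Longrightarrow> i < c \<Longrightarrow> vs ! a \<in> cycle_edge vs i \<longleftrightarrow> i = a \<or> i = prev a"
  using Suc_mod_eq_iff[of i a] by (auto simp: cycle_edge_def)

text \<open>Two positions with the same edge would be cyclic successors of each other, which
  requires length 2.\<close>

lemma inj_cycle_edge: "inj_on (cycle_edge vs) {..<c}"
proof (rule inj_onI)
  fix i j assume ij: "i \<in> {..<c}" "j \<in> {..<c}" "cycle_edge vs i = cycle_edge vs j"
  then have "i = Suc j mod c \<and> Suc i mod c = j \<or> i = j"
    by (auto simp: cycle_edge_def doubleton_eq_iff)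
  then show "i = j" using ij length by (auto simp: mod_Suc' split: if_splits)
qed

lemma card_cycle_edges: "card (cycle_edges vs) = c"
  unfolding cycle_edges_image by (simp add: card_image inj_cycle_edge)

lemma finite_cycle_edges [simp]: "finite (cycle_edges vs)"
  unfolding cycle_edges_image by simp

lemma edges_at: "a < c \<Longrightarrow> {e \<in> cycle_edges vs. vs ! a \<in> e} = {cycle_edge vs a, cycle_edge vs (prev a)}"
  using nth_in_cycle_edge prev(1) by (auto simp: cycle_edges_image)

lemma Union_cycle_edges: "\<Union>(cycle_edges vs) = set vs"
proof (intro equalityI subsetI)
  fix x assume "x \<in> set vs"
  then obtain i where "i < c" "x = vs ! i" by (auto simp: in_set_conv_nth)
  then show "x \<in> \<Union>(cycle_edges vs)" by (auto simp: cycle_edges_image cycle_edge_def)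
qed (use cycle_edge_subset in \<open>auto simp: cycle_edges_image\<close>)

lemma card_cycle_edge: "i < c \<Longrightarrow> card (cycle_edge vs i) = 2"
  using nth_Suc_mod_neq[of i] by (simp add: cycle_edge_def card_2_iff' card_insert_if)

lemma degree: "a < c \<Longrightarrow> vertex_degree (cycle_edges vs) (vs ! a) = 2"
  unfolding vertex_degree_def edges_at
  using prev[of a] inj_on_eq_iff[OF inj_cycle_edge, of a "prev a"] by auto

lemma not_connected_if_two_missing:
  assumes S: "S \<subseteq> cycle_edges vs" and ij: "i < j" "j < c" "cycle_edge vs i \<notin> S" "cycle_edge vs j \<notin> S"
  shows "\<not> connected_graph (set vs) S"
proof
  assume c: "connected_graph (set vs) S"
  \<comment> \<open>Without the edges i and j, nothing joins the arc from i + 1 to j with the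
    rest.\<close>
  let ?X = "(!) vs ` {i<..j}"
  have *: "e \<subseteq> ?X \<or> e \<inter> ?X = {}" if e: "e \<in> S" for e
  proof -
    obtain t where t: "t < c" "e = cycle_edge vs t" using S e by (auto simp: cycle_edges_image)
    have X: "vs ! s \<in> ?X \<longleftrightarrow> i < s \<and> s \<le> j" if "s < c" for s
      using that ij by auto
    have "t \<noteq> i" "t \<noteq> j" using ij e t by auto
    then have "i < t \<and> t \<le> j \<longleftrightarrow> i < Suc t mod c \<and> Suc t mod c \<le> j"
      using t ij by (auto simp: mod_Suc')
    then have "vs ! t \<in> ?X \<longleftrightarrow> vs ! (Suc t mod c) \<in> ?X" using X[of t] X[of "Suc t mod c"] t by simp
    then show ?thesis unfolding t(2) cycle_edge_def by blast
  qed
  have "vs ! i \<in> ?X"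
    by (rule connected_graph_closed[OF c _ _ _ *, of "vs ! j"]) (use ij in auto)
  then show False using ij by auto
qed

text \<open>Cutting the cycle at edge j leaves a path. Starting at position 0, it is followed
  upwards to j, and over the closing edge backwards from c - 1 down to j + 1.\<close>

lemma connected_if_one_missing:
  assumes j: "j < c" and S: "cycle_edges vs - {cycle_edge vs j} \<subseteq> S"
  shows "connected_graph (set vs) S"
proof -
  have e: "cycle_edge vs i \<in> S" if "i < c" "i \<noteq> j" for i
    using that S inj_on_eq_iff[OF inj_cycle_edge, of i j] j by (auto simp: cycle_edges_image)
  have up: "(vs ! 0, vs ! t) \<in> (adj S)\<^sup>*" if "t \<le> j" for t
    using that
  proof (induction t)
    case (Suc t)
    then have "{vs ! t, vs ! Suc t} \<in> S" using e[of t] j by (simp add: cycle_edge_def mod_Suc')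
    then show ?case using Suc by (meson Suc_leD adj_rtrancl_edge rtrancl_trans)
  qed simp
  have down: "(vs ! 0, vs ! (c - Suc d)) \<in> (adj S)\<^sup>*" if "j + Suc d < c" for d
    using that
  proof (induction d)
    case 0
    then have "cycle_edge vs (c - 1) \<in> S" using e[of "c - 1"] by simp
    then have "{vs ! (c - 1), vs ! 0} \<in> S" by (simp add: cycle_edge_def)
    then show ?case using adj_rtrancl_edge[of "vs ! 0"] by (simp add: insert_commute)
  next
    case (Suc d)
    then have "{vs ! (c - Suc (Suc d)), vs ! (c - Suc d)} \<in> S"
      using e[of "c - Suc (Suc d)"] by (simp add: cycle_edge_def mod_Suc' Suc_diff_Suc)
    then have "{vs ! (c - Suc d), vs ! (c - Suc (Suc d))} \<in> S" by (simp add: insert_commute)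
    moreover have "(vs ! 0, vs ! (c - Suc d)) \<in> (adj S)\<^sup>*" using Suc by simp
    ultimately show ?case by (meson adj_rtrancl_edge rtrancl_trans)
  qed
  show ?thesis
  proof (rule connected_graphI[of "vs ! 0"])
    show "vs ! 0 \<in> set vs" using length by (intro nth_mem) auto
    fix y assume "y \<in> set vs"
    then obtain t where t: "t < c" "y = vs ! t" by (auto simp: in_set_conv_nth)
    show "(vs ! 0, y) \<in> (adj S)\<^sup>*"
    proof (cases "t \<le> j")
      case True
      then show ?thesis using up t by simp
    next
      case False
      then show ?thesis using down[of "c - Suc t"] t by simp
    qed
  qed
qed

lemma connected_iff:
  assumes S: "S \<subseteq> cycle_edges vs"
  shows "connected_graph (set vs) S \<longleftrightarrow> S = cycle_edges vs \<or> (\<exists>j<c. S = cycle_edges vs - {cycle_edge vs j})"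
proof
  assume con: "connected_graph (set vs) S"
  have "i = j" if "i < c" "j < c" "cycle_edge vs i \<notin> S" "cycle_edge vs j \<notin> S" for i j
    using not_connected_if_two_missing[OF S, of i j] not_connected_if_two_missing[OF S, of j i] con that
    by (metis linorder_neqE_nat)
  then show "S = cycle_edges vs \<or> (\<exists>j<c. S = cycle_edges vs - {cycle_edge vs j})"
    using S unfolding cycle_edges_image by blast
next
  assume "S = cycle_edges vs \<or> (\<exists>j<c. S = cycle_edges vs - {cycle_edge vs j})"
  then obtain j where "j < c" "cycle_edges vs - {cycle_edge vs j} \<subseteq> S"
    using length by (metis Diff_subset order_refl less_le_trans zero_less_numeral)
  then show "connected_graph (set vs) S" by (rule connected_if_one_missing)
qed

text \<open>The full cycle contributes (-1)^c and each of the c edge sets with one edge removed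
  contributes -(-1)^c.\<close>

lemma connected_sum_cycle:
  "connected_sum (cycle_edges vs) (set vs) = - ((-1) ^ c) * (of_nat c - 1)"
proof -
  let ?C = "cycle_edges vs"
  have "{S. S \<subseteq> ?C \<and> \<Union>S \<subseteq> set vs \<and> connected_graph (set vs) S} = insert ?C ((\<lambda>e. ?C - {e}) ` ?C)"
  proof (intro set_eqI iffI)
    fix S assume "S \<in> {S. S \<subseteq> ?C \<and> \<Union>S \<subseteq> set vs \<and> connected_graph (set vs) S}"
    then show "S \<in> insert ?C ((\<lambda>e. ?C - {e}) ` ?C)"
      using connected_iff[of S] by (auto simp: cycle_edges_image)
  next
    fix S assume S: "S \<in> insert ?C ((\<lambda>e. ?C - {e}) ` ?C)"
    then have "S \<subseteq> ?C" by auto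
    moreover from this have "\<Union>S \<subseteq> set vs" using Union_cycle_edges by auto
    moreover have "connected_graph (set vs) S"
      using S connected_iff[of S] calculation(1) by (auto simp: cycle_edges_image)
    ultimately show "S \<in> {S. S \<subseteq> ?C \<and> \<Union>S \<subseteq> set vs \<and> connected_graph (set vs) S}" by simp
  qed
  moreover have "?C \<notin> (\<lambda>e. ?C - {e}) ` ?C" by auto
  moreover have "inj_on (\<lambda>e. ?C - {e}) ?C" by (rule inj_onI) auto
  ultimately have "connected_sum ?C (set vs) = (-1) ^ c + (\<Sum>e\<in>?C. (-1) ^ card (?C - {e}))"
    by (simp add: connected_sum_def sum.reindex card_cycle_edges)
  also have "(\<Sum>e\<in>?C. (-1) ^ card (?C - {e})) = (\<Sum>e\<in>?C. (-1 :: rat) ^ (c - 1))"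
    by (intro sum.cong) (simp_all add: card_cycle_edges)
  also have "\<dots> = - (of_nat c * (-1) ^ c)"
    using length by (cases c) (simp_all add: card_cycle_edges)
  finally show ?thesis by (simp add: algebra_simps)
qed

text \<open>Connectivity on the path is reduced to the cycle: reattaching the deleted vertex by one
  of its two edges gives a subset of the cycle that lacks the other edge, so it must lack nothing
  else. The single connected edge set has c - 2 edges.\<close>

lemma connected_sum_path:
  assumes a: "a < c"
  shows "connected_sum (cycle_edges vs) (set vs - {vs ! a}) = (-1) ^ c"
proof -
  let ?C = "cycle_edges vs" and ?e = "cycle_edge vs a" and ?f = "cycle_edge vs (prev a)"
  let ?K = "set vs - {vs ! a}"
  have K: "insert (vs ! a) ?K = set vs" using a by auto
  have ef: "?e \<in> ?C" "?f \<in> ?C" "?e \<noteq> ?f"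
    using prev[OF a] a inj_on_eq_iff[OF inj_cycle_edge, of a "prev a"] by (auto simp: cycle_edges_image)
  have w: "vs ! (Suc a mod c) \<in> ?K"
    using a nth_Suc_mod_neq[OF a] by simp
  have "{S. S \<subseteq> ?C \<and> \<Union>S \<subseteq> ?K \<and> connected_graph ?K S} = {?C - {?e, ?f}}"
  proof -
    have con: "connected_graph ?K S \<longleftrightarrow> S = ?C - {?e, ?f}" if S: "S \<subseteq> ?C - {?e, ?f}" "vs ! a \<notin> \<Union>S" for S
    proof -
      have "connected_graph ?K S \<longleftrightarrow> connected_graph (set vs) (insert ?e S)"
        using connected_graph_pendant[of "vs ! a" ?K S "vs ! (Suc a mod c)"] S w K
        by (simp add: cycle_edge_def)
      also have "\<dots> \<longleftrightarrow> insert ?e S = ?C - {?f}"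
      proof -
        have "insert ?e S \<subseteq> ?C" using S ef by auto
        moreover have "?f \<notin> insert ?e S" using S ef by blast
        then have "insert ?e S \<noteq> ?C" "insert ?e S = ?C - {x} \<Longrightarrow> x = ?f" for x using ef by blast+
        ultimately show ?thesis using connected_iff[of "insert ?e S"] prev(1)[OF a] by metis
      qed
      also have "\<dots> \<longleftrightarrow> S = ?C - {?e, ?f}" using S ef by auto
      finally show ?thesis .
    qed
    have at: "vs ! a \<in> e \<longleftrightarrow> e = ?e \<or> e = ?f" if "e \<in> ?C" for e
      using edges_at[OF a] that by auto
    show ?thesis
    proof (intro set_eqI iffI)
      fix S assume S: "S \<in> {S. S \<subseteq> ?C \<and> \<Union>S \<subseteq> ?K \<and> connected_graph ?K S}"
      then have "vs ! a \<notin> \<Union>S" by auto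
      moreover from this have "S \<subseteq> ?C - {?e, ?f}" using S at by auto
      ultimately show "S \<in> {?C - {?e, ?f}}" using con[of S] S by auto
    next
      fix S assume "S \<in> {?C - {?e, ?f}}"
      then have S: "S = ?C - {?e, ?f}" by simp
      then have "vs ! a \<notin> \<Union>S" using at by auto
      moreover from this have "\<Union>S \<subseteq> ?K" using S Union_cycle_edges by auto
      ultimately show "S \<in> {S. S \<subseteq> ?C \<and> \<Union>S \<subseteq> ?K \<and> connected_graph ?K S}"
        using con[of S] S by auto
    qed
  qed
  moreover have "card (?C - {?e, ?f}) = c - 2"
    using ef by (subst card_Diff_subset) (auto simp: card_cycle_edges)
  moreover have "(-1 :: rat) ^ (c - 2) = (-1) ^ c"
    using length by (subst (2) le_add_diff_inverse2[of 2 c, symmetric]) (simp_all add: power_add del: le_add_diff_inverse2)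
  ultimately show ?thesis by (simp add: connected_sum_def)
qed

text \<open>The missing vertices cut the cycle into two arcs. As K meets every edge, the successors
  of both belong to K, and they lie on different arcs, which no edge of S joins.\<close>

lemma not_connected_if_two_vertices_missing:
  assumes S: "S \<subseteq> cycle_edges vs" "\<Union>S \<subseteq> K" and ab: "a < b" "b < c" "vs ! a \<notin> K" "vs ! b \<notin> K"
    and cover: "\<And>e. e \<in> cycle_edges vs \<Longrightarrow> e \<inter> K \<noteq> {}"
  shows "\<not> connected_graph K S"
proof
  assume con: "connected_graph K S"
  let ?X = "(!) vs ` {a<..<b}"
  have X: "vs ! s \<in> ?X \<longleftrightarrow> a < s \<and> s < b" if "s < c" for s
    using that ab by auto
  have next_in: "vs ! (Suc i mod c) \<in> K" if "i < c" "vs ! i \<notin> K" for i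
    using cover[of "cycle_edge vs i"] that by (auto simp: cycle_edges_image cycle_edge_def)
  have *: "e \<subseteq> ?X \<or> e \<inter> ?X = {}" if e: "e \<in> S" for e
  proof -
    obtain t where t: "t < c" "e = cycle_edge vs t" using S e by (auto simp: cycle_edges_image)
    have "vs ! t \<in> K" "vs ! (Suc t mod c) \<in> K" using S e t by (auto simp: cycle_edge_def)
    then have "t \<noteq> a" "t \<noteq> b" "Suc t mod c \<noteq> a" "Suc t mod c \<noteq> b" using ab by auto
    then have "a < t \<and> t < b \<longleftrightarrow> a < Suc t mod c \<and> Suc t mod c < b"
      using t ab by (auto simp: mod_Suc' split: if_splits)
    then have "vs ! t \<in> ?X \<longleftrightarrow> vs ! (Suc t mod c) \<in> ?X" using X[of t] X[of "Suc t mod c"] t by simp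
    then show ?thesis unfolding t(2) cycle_edge_def by blast
  qed
  have a1: "vs ! Suc a \<in> K" using next_in[of a] ab by (simp add: mod_Suc')
  then have "Suc a < b" using ab by (metis Suc_lessI)
  then have aX: "vs ! Suc a \<in> ?X" using ab by auto
  have b1: "vs ! (Suc b mod c) \<in> K" using next_in[of b] ab by simp
  have "vs ! (Suc b mod c) \<in> ?X" by (rule connected_graph_closed[OF con a1 aX b1 *])
  then have "a < Suc b mod c \<and> Suc b mod c < b" using X by simp
  then show False using ab by (auto simp: mod_Suc' split: if_splits)
qed

text \<open>Base case of the later induction: on a bare cycle every vertex is internal. The signs
  are expressed by |K|, which is c or c - 1 in the nonzero cases, because this form survives the
  attachment of vertices.\<close>

lemma cover_sum_cycle:
  assumes K: "K \<subseteq> set vs" "K \<noteq> {}"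
  shows "cover_sum (cycle_edges vs) K =
    (if set vs \<subseteq> K then - ((-1) ^ card K) * (of_nat c - 1)
     else if \<exists>u. set vs - K = {u} then - ((-1) ^ card K) else 0)"
proof -
  have cardV: "card (set vs) = c" using distinct by (rule distinct_card)
  consider "K = set vs" | u where "set vs - K = {u}" | x y where "x \<in> set vs - K" "y \<in> set vs - K" "x \<noteq> y"
    using K by blast
  then show ?thesis
  proof cases
    case 1
    have "\<forall>e\<in>cycle_edges vs. e \<inter> K \<noteq> {}"
      using 1 cycle_edge_subset by (auto simp: cycle_edges_image cycle_edge_def)
    then show ?thesis using 1 connected_sum_cycle cardV by (simp add: cover_sum_def)
  next
    case 2
    then obtain a where a: "a < c" "u = vs ! a" by (metis Diff_iff in_set_conv_nth insertI1)
    have Ka: "K = set vs - {vs ! a}" using 2 K a by auto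
    have "\<forall>e\<in>cycle_edges vs. e \<inter> K \<noteq> {}"
    proof
      fix e assume e: "e \<in> cycle_edges vs"
      then have "card e = 2" "e \<subseteq> set vs" using card_cycle_edge cycle_edge_subset by (auto simp: cycle_edges_image)
      then show "e \<inter> K \<noteq> {}" unfolding Ka by (auto simp: card_2_iff)
    qed
    moreover have "card K = c - 1" using a cardV unfolding Ka by simp
    moreover have "- ((-1 :: rat) ^ (c - 1)) = (-1) ^ c" using length by (cases c) simp_all
    ultimately show ?thesis using 2 connected_sum_path[OF a(1)] unfolding cover_sum_def Ka by auto
  next
    case 3
    then obtain i j where ij: "i < c" "j < c" "x = vs ! i" "y = vs ! j" by (metis Diff_iff in_set_conv_nth)
    then have nc: "\<not> connected_graph K S" if "S \<subseteq> cycle_edges vs" "\<Union>S \<subseteq> K" "\<And>e. e \<in> cycle_edges vs \<Longrightarrow> e \<inter> K \<noteq> {}" for S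
    proof (cases "i < j")
      case True
      show ?thesis by (rule not_connected_if_two_vertices_missing[OF that(1,2) True _ _ _ that(3)])
          (use 3 ij in auto)
    next
      case False
      then have "j < i" using 3 ij by auto
      show ?thesis by (rule not_connected_if_two_vertices_missing[OF that(1,2) \<open>j < i\<close> _ _ _ that(3)])
          (use 3 ij in auto)
    qed
    have "cover_sum (cycle_edges vs) K = 0"
    proof (cases "\<forall>e\<in>cycle_edges vs. e \<inter> K \<noteq> {}")
      case True
      have "\<not> (S \<subseteq> cycle_edges vs \<and> \<Union>S \<subseteq> K \<and> connected_graph K S)" for S
        using nc[of S] True by meson
      then have "connected_sum (cycle_edges vs) K = 0" unfolding connected_sum_def
        by (intro sum.neutral) blast
      then show ?thesis by (simp add: cover_sum_def)
    qed (auto simp: cover_sum_def)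
    moreover have "\<not> set vs \<subseteq> K" "\<not> (\<exists>u. set vs - K = {u})" using 3 by (blast, metis singletonD)
    ultimately show ?thesis by simp
  qed
qed

end

section \<open>Unicyclic graphs by pendant extension\<close>

text \<open>The walk is shortened to a path while it is built from the front: if the new first
  vertex already occurs, the suffix starting there is kept.\<close>

lemma adj_rtrancl_path:
  assumes "(x, y) \<in> (adj E)\<^sup>*"
  shows "\<exists>vs. distinct vs \<and> vs \<noteq> [] \<and> hd vs = x \<and> last vs = y \<and>
    (\<forall>i. Suc i < length vs \<longrightarrow> {vs ! i, vs ! Suc i} \<in> E)"
  using assms
proof (induction rule: converse_rtrancl_induct)
  case base
  show ?case by (rule exI[of _ "[y]"]) simp
next
  case (step x z)
  then obtain vs where vs: "distinct vs" "vs \<noteq> []" "hd vs = z" "last vs = y"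
    "\<And>i. Suc i < length vs \<Longrightarrow> {vs ! i, vs ! Suc i} \<in> E" by blast
  show ?case
  proof (cases "x \<in> set vs")
    case True
    then obtain j where j: "j < length vs" "vs ! j = x" by (auto simp: in_set_conv_nth)
    show ?thesis
      using vs j by (intro exI[of _ "drop j vs"]) (auto simp: hd_drop_conv_nth)
  next
    case False
    have "{(x # vs) ! i, (x # vs) ! Suc i} \<in> E" if "Suc i < length (x # vs)" for i
    proof (cases i)
      case 0
      then show ?thesis using step(1) vs(2,3) by (simp add: adj_def hd_conv_nth)
    next
      case (Suc k)
      then show ?thesis using that vs(5)[of k] by simp
    qed
    then show ?thesis using vs False by (intro exI[of _ "x # vs"]) simp
  qed
qed

text \<open>The new edge closes a path from x to y. The path has at least three vertices, since x
  and y differ and {x, y} is not yet an edge.\<close>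

lemma cycle_through_new_edge:
  assumes "(x, y) \<in> (adj E)\<^sup>*" "x \<noteq> y" "{x, y} \<notin> E"
  shows "\<exists>C. is_cycle (insert {x, y} E) C \<and> {x, y} \<in> C"
proof -
  obtain vs where vs: "distinct vs" "vs \<noteq> []" "hd vs = x" "last vs = y"
    "\<And>i. Suc i < length vs \<Longrightarrow> {vs ! i, vs ! Suc i} \<in> E"
    using adj_rtrancl_path[OF assms(1)] by blast
  have h: "vs ! 0 = x" "vs ! (length vs - 1) = y" using vs by (simp_all add: hd_conv_nth last_conv_nth)
  have "length vs \<noteq> 1" using h assms(2) by auto
  moreover have "length vs \<noteq> 2" using h assms(3) vs(5)[of 0] by auto
  ultimately have len: "length vs \<ge> 3" using vs(2) by (cases vs rule: remdups_adj.cases) (auto simp: Suc_le_eq)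
  have last: "cycle_edge vs (length vs - 1) = {x, y}"
    using h vs(2) by (auto simp: cycle_edge_def)
  have "cycle_edge vs i \<in> insert {x, y} E" if "i < length vs" for i
  proof (cases "Suc i = length vs")
    case True
    then have "i = length vs - 1" by simp
    then show ?thesis using last by simp
  next
    case False
    then show ?thesis using that vs(5)[of i] by (simp add: cycle_edge_def)
  qed
  then have "cycle_edges vs \<subseteq> insert {x, y} E" by (auto simp: cycle_edges_image)
  moreover have "{x, y} \<in> cycle_edges vs"
    unfolding cycle_edges_image last[symmetric] using vs(2) by simp
  ultimately have "is_cycle (insert {x, y} E) (cycle_edges vs) \<and> {x, y} \<in> cycle_edges vs"
    using vs(1) len unfolding is_cycle_def cycle_edges_def by blast
  then show ?thesis by blast
qed

lemma is_cycle_iff: "is_cycle E C \<longleftrightarrow> C \<subseteq> E \<and> (\<exists>vs. cycle_list vs \<and> C = cycle_edges vs)"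
  by (auto simp: is_cycle_def cycle_list_def cycle_edges_def)

lemma is_cycle_mono: "is_cycle F D \<Longrightarrow> F \<subseteq> E \<Longrightarrow> is_cycle E D"
  unfolding is_cycle_iff by (elim conjE) (intro conjI, rule subset_trans, assumption+)

text \<open>As v lies outside V, {v, w} is the only edge at v, which is the situation of
  \<open>connected_sum_pendant\<close>. C is a parameter because it stays the same during the whole
  construction.\<close>

inductive pendant_extension :: "'a set set \<Rightarrow> 'a set \<Rightarrow> 'a set set \<Rightarrow> bool" for C where
  cycle: "cycle_list vs \<Longrightarrow> C = cycle_edges vs \<Longrightarrow> pendant_extension C (set vs) C"
| pendant: "pendant_extension C V E \<Longrightarrow> w \<in> V \<Longrightarrow> v \<notin> V \<Longrightarrow>
    pendant_extension C (insert v V) (insert {v, w} E)"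

lemma pendant_extension_basic:
  assumes "pendant_extension C V E"
  shows "finite V \<and> finite E \<and> (\<forall>e\<in>E. e \<subseteq> V) \<and> C \<subseteq> E \<and> connected_graph V E \<and> E \<noteq> {} \<and> (\<forall>e\<in>E. card e = 2)"
  using assms
proof induction
  case (cycle vs)
  interpret cycle_list vs by fact
  have "connected_graph (set vs) (cycle_edges vs)" by (simp add: connected_iff)
  moreover have "cycle_edges vs \<noteq> {}" using card_cycle_edges length by auto
  moreover have "\<forall>e\<in>cycle_edges vs. card e = 2" by (auto simp: cycle_edges_image card_cycle_edge)
  ultimately show ?case using cycle Union_cycle_edges by auto
next
  case (pendant V E w v)
  then have "v \<notin> \<Union>E" by auto
  moreover have "card {v, w} = 2" using pendant by (auto simp: card_insert_if)
  ultimately show ?case using pendant connected_graph_pendant[of v V E w] by auto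
qed

lemma unicyclic_pendant_extension:
  assumes G: "simple_graph V E" "connected_graph V E" and C: "is_cycle E C"
    and uniq: "\<And>D. is_cycle E D \<Longrightarrow> D = C"
  shows "pendant_extension C V E"
proof -
  have finV: "finite V" and EV: "\<And>e. e \<in> E \<Longrightarrow> e \<subseteq> V" and E2: "\<And>e. e \<in> E \<Longrightarrow> card e = 2"
    using G(1) by (auto simp: simple_graph_def)
  define P where "P W \<longleftrightarrow> W \<subseteq> V \<and> (\<exists>F\<subseteq>E. pendant_extension C W F)" for W
  obtain vs where vs: "cycle_list vs" "C = cycle_edges vs" "C \<subseteq> E"
    using C by (auto simp: is_cycle_iff)
  have "P (set vs)"
    unfolding P_def using pendant_extension.cycle[OF vs(1,2)] vs(3) EV cycle_list.Union_cycle_edges[OF vs(1)] vs(2)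
    by (metis Union_least in_mono)
  moreover have "\<forall>W. P W \<longrightarrow> card W < Suc (card V)"
    using finV by (auto simp: P_def less_Suc_eq_le intro: card_mono)
  ultimately have "\<exists>W. P W \<and> (\<forall>W'. P W' \<longrightarrow> card W' \<le> card W)"
    by (rule ex_has_greatest_nat)
  then obtain W where W: "P W" "\<And>W'. P W' \<Longrightarrow> card W' \<le> card W" by auto
  then obtain F where F: "W \<subseteq> V" "F \<subseteq> E" "pendant_extension C W F" by (auto simp: P_def)
  note FB = pendant_extension_basic[OF F(3)]
  have "W = V"
  proof (rule ccontr)
    assume "W \<noteq> V"
    then obtain y where y: "y \<in> V" "y \<notin> W" using F(1) by auto
    obtain x where x: "x \<in> W" using FB by (auto simp: connected_graph_def)
    have "\<exists>e\<in>E. \<not> (e \<subseteq> W \<or> e \<inter> W = {})"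
      using connected_graph_closed[OF G(2), of x W y] x y F(1) by blast
    then obtain e a b where e: "e \<in> E" "a \<in> e" "a \<in> W" "b \<in> e" "b \<notin> W" by blast
    then have "e = {b, a}" using E2[OF e(1)] by (auto simp: card_2_iff)
    then have "P (insert b W)"
      unfolding P_def using pendant_extension.pendant[OF F(3) e(3,5)] e EV F(1,2)
      by (intro conjI exI[of _ "insert {b, a} F"]) auto
    then show False using W(2)[of "insert b W"] e FB by simp
  qed
  moreover have "F = E"
  proof (rule ccontr)
    assume "F \<noteq> E"
    then obtain e where e: "e \<in> E" "e \<notin> F" using F(2) by auto
    then obtain x y where xy: "e = {x, y}" "x \<noteq> y" using E2 by (meson card_2_iff)
    then have "(x, y) \<in> (adj F)\<^sup>*" using FB EV[OF e(1)] \<open>W = V\<close> by (simp add: connected_graph_def)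
    then obtain D where D: "is_cycle (insert {x, y} F) D" "{x, y} \<in> D"
      using cycle_through_new_edge xy e by metis
    have "insert {x, y} F \<subseteq> E" using e F(2) xy by auto
    with D(1) have "is_cycle E D" by (rule is_cycle_mono)
    then have "D = C" by (rule uniq)
    then show False using D(2) FB e xy by auto
  qed
  ultimately show ?thesis using F by simp
qed

section \<open>Degrees, internal vertices and internal edges\<close>

abbreviation internal_vertices :: "'a set set \<Rightarrow> 'a set" where
  "internal_vertices E \<equiv> {v. internal_vertex E v}"

lemma vertex_degree_insert:
  assumes "finite E" "f \<notin> E"
  shows "vertex_degree (insert f E) x = (if x \<in> f then 1 else 0) + vertex_degree E x"
proof -
  have "{e \<in> insert f E. x \<in> e} = (if x \<in> f then insert f {e \<in> E. x \<in> e} else {e \<in> E. x \<in> e})" by auto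
  then show ?thesis using assms by (simp add: vertex_degree_def)
qed

lemma vertex_degree_0: "x \<notin> \<Union>E \<Longrightarrow> vertex_degree E x = 0"
  unfolding vertex_degree_def by (auto simp: card_eq_0_iff)

lemma internal_vertices_pendant:
  assumes E: "finite E" "\<forall>e\<in>E. e \<subseteq> V" and v: "v \<notin> V" and w: "w \<in> V" "vertex_degree E w \<ge> 1"
  shows "internal_vertices (insert {v, w} E) = insert w (internal_vertices E)"
    "vertex_degree (insert {v, w} E) w = Suc (vertex_degree E w)"
    "x \<noteq> v \<Longrightarrow> x \<noteq> w \<Longrightarrow> vertex_degree (insert {v, w} E) x = vertex_degree E x"
proof -
  have n: "{v, w} \<notin> E" using E(2) v by auto
  note deg = vertex_degree_insert[OF E(1) n]
  show "vertex_degree (insert {v, w} E) w = Suc (vertex_degree E w)" using deg by simp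
  show "x \<noteq> v \<Longrightarrow> x \<noteq> w \<Longrightarrow> vertex_degree (insert {v, w} E) x = vertex_degree E x"
    using deg by simp
  have "v \<notin> \<Union>E" using E(2) v by auto
  then have "vertex_degree E v = 0" by (rule vertex_degree_0)
  then show "internal_vertices (insert {v, w} E) = insert w (internal_vertices E)"
    using w v by (auto simp: internal_vertex_def deg)
qed

text \<open>Attaching at an internal w changes neither internal vertices nor internal edges. If w
  was a leaf, then w and its only former edge become internal together, so the two cardinalities
  stay equal. That the other end of this edge is internal is what the second conjunct
  provides.\<close>

lemma pendant_extension_degrees:
  assumes "pendant_extension C V E"
  shows "(\<forall>v\<in>V. vertex_degree E v \<ge> 1) \<and> (\<forall>e\<in>E. \<exists>z\<in>e. vertex_degree E z \<ge> 2) \<and>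
    internal_vertices E \<subseteq> V \<and> \<Union>C \<subseteq> V \<and> \<Union>C \<subseteq> internal_vertices E \<and>
    card (internal_edges E) = card (internal_vertices E)"
  using assms
proof induction
  case (cycle vs)
  interpret cycle_list vs by fact
  have deg: "vertex_degree C v = 2" if "v \<in> set vs" for v
    using that degree cycle(2) by (auto simp: in_set_conv_nth)
  have UC: "\<Union>C = set vs" using Union_cycle_edges cycle by simp
  have iv: "internal_vertices C = set vs"
  proof (intro equalityI subsetI)
    fix x assume "x \<in> internal_vertices C"
    then have "vertex_degree C x \<noteq> 0" by (simp add: internal_vertex_def)
    then show "x \<in> set vs" using vertex_degree_0[of x C] UC by auto
  qed (use deg in \<open>simp add: internal_vertex_def\<close>)
  have "internal_edges C = C" using iv UC by (auto simp: internal_edges_def)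
  moreover have "card C = card (set vs)" using cycle card_cycle_edges distinct by (simp add: distinct_card)
  moreover have "\<exists>z\<in>e. vertex_degree C z \<ge> 2" if "e \<in> C" for e
  proof -
    have "e \<in> cycle_edge vs ` {..<c}" using that cycle(2) by (simp only: cycle_edges_image)
    then obtain i where i: "i < c" "e = cycle_edge vs i" by auto
    show ?thesis by (rule bexI[of _ "vs ! i"]) (use i deg[of "vs ! i"] in \<open>simp_all add: cycle_edge_def\<close>)
  qed
  ultimately show ?case using iv UC deg by simp
next
  case (pendant V E w v)
  note B = pendant_extension_basic[OF pendant.hyps(1)]
  let ?E = "insert {v, w} E"
  have dw: "vertex_degree E w \<ge> 1" using pendant by simp
  note I = internal_vertices_pendant[of E V v w, OF _ _ pendant.hyps(3,2) dw]
  have fE: "finite E" "\<forall>e\<in>E. e \<subseteq> V" using B by auto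
  have n: "{v, w} \<notin> E" using fE pendant.hyps by auto
  note deg = vertex_degree_insert[OF fE(1) n]
  have IV: "internal_vertices ?E = insert w (internal_vertices E)" by (rule I(1)[OF fE])
  have fI: "finite (internal_vertices E)" using pendant.IH B by (meson finite_subset)
  have v: "\<not> internal_vertex ?E v" using IV pendant.hyps pendant.IH by auto
  have card: "card (internal_edges ?E) = card (internal_vertices ?E)"
  proof (cases "internal_vertex E w")
    case True
    then have "internal_vertices ?E = internal_vertices E" using IV by auto
    moreover have "internal_edges ?E = internal_edges E"
      using v calculation by (auto simp: internal_edges_def)
    ultimately show ?thesis using pendant by simp
  next
    case False
    then have "vertex_degree E w = 1" using dw by (simp add: internal_vertex_def)
    \<comment> \<open>The only edge at the former leaf w, and the one edge that newly becomes
      internal.\<close>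
    then obtain f where f: "{e \<in> E. w \<in> e} = {f}" unfolding vertex_degree_def by (auto simp: card_1_singleton_iff)
    have fI': "z \<in> internal_vertices ?E" if "z \<in> f" for z
    proof (cases "z = w")
      case False
      have "f \<in> E" "w \<in> f" using f by auto
      then obtain u where u: "u \<in> f" "vertex_degree E u \<ge> 2" using pendant.IH by blast
      have "u \<noteq> w" using u(2) \<open>vertex_degree E w = 1\<close> by auto
      moreover have "card f = 2" using B \<open>f \<in> E\<close> by simp
      ultimately have "u = z" using u(1) \<open>w \<in> f\<close> that False by (auto simp: card_2_iff)
      then show ?thesis using u IV by (simp add: internal_vertex_def)
    qed (use IV in simp)
    have "internal_edges ?E = insert f (internal_edges E)"
    proof (intro equalityI subsetI)
      fix e assume "e \<in> internal_edges ?E"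
      then have e: "e \<in> E" "\<forall>z\<in>e. z \<in> internal_vertices ?E" using v by (auto simp: internal_edges_def)
      show "e \<in> insert f (internal_edges E)"
      proof (cases "w \<in> e")
        case True
        then show ?thesis using f e by auto
      next
        case False
        then show ?thesis using e IV by (auto simp: internal_edges_def)
      qed
    next
      fix e assume "e \<in> insert f (internal_edges E)"
      then show "e \<in> internal_edges ?E"
        using f fI' IV by (auto simp: internal_edges_def)
    qed
    moreover have "f \<notin> internal_edges E" using f False by (auto simp: internal_edges_def)
    moreover have "finite (internal_edges E)" using fE by (simp add: internal_edges_def)
    ultimately show ?thesis using IV False fI pendant.IH by simp
  qed
  have "\<forall>x\<in>insert v V. vertex_degree ?E x \<ge> 1"
    using pendant.IH by (auto simp: deg intro: le_SucI)
  moreover have "\<forall>e\<in>?E. \<exists>z\<in>e. vertex_degree ?E z \<ge> 2"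
  proof
    fix e assume "e \<in> ?E"
    then show "\<exists>z\<in>e. vertex_degree ?E z \<ge> 2"
    proof
      assume "e = {v, w}"
      then show ?thesis using dw by (auto simp: deg)
    next
      assume "e \<in> E"
      then obtain z where "z \<in> e" "vertex_degree E z \<ge> 2" using pendant.IH by blast
      then show ?thesis by (auto simp: deg intro!: bexI[of _ z])
    qed
  qed
  ultimately show ?case using card IV pendant by auto
qed


text \<open>If w is missing from K, both sides are 0. If w is in K, passing to K - {v} changes
  neither the covering condition nor the missing internal vertices, and it flips both signs exactly
  when v is in K.\<close>

lemma pendant_extension_cover_sum:
  assumes "pendant_extension C V E" "K \<subseteq> V" "K \<noteq> {}"
  shows "cover_sum E K =
    (if internal_vertices E \<subseteq> K then - ((-1) ^ card K) * (of_nat (card (\<Union>C)) - 1)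
     else if \<exists>u\<in>\<Union>C. internal_vertices E - K = {u} \<and> vertex_degree E u = 2 then - ((-1) ^ card K) else 0)"
  using assms
proof (induction arbitrary: K)
  case (cycle vs)
  interpret cycle_list vs by fact
  note D = pendant_extension_degrees[OF pendant_extension.cycle[OF cycle(1,2)]]
  have UC: "\<Union>C = set vs" using Union_cycle_edges cycle by simp
  then have I: "internal_vertices C = set vs" using D by auto
  have card: "card (\<Union>C) = c" unfolding UC by (simp add: distinct_card distinct)
  have "(\<exists>u\<in>\<Union>C. internal_vertices C - K = {u} \<and> vertex_degree C u = 2) \<longleftrightarrow> (\<exists>u. set vs - K = {u})"
    unfolding UC I using degree cycle(2) by (metis Diff_iff in_set_conv_nth insertI1)
  then show ?case unfolding I card using cover_sum_cycle[OF cycle(3,4)] cycle(2) by simp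
next
  case (pendant V E w v)
  note B = pendant_extension_basic[OF pendant.hyps(1)]
  note D = pendant_extension_degrees[OF pendant.hyps(1)]
  let ?E = "insert {v, w} E"
  have fE: "finite E" "\<forall>e\<in>E. e \<subseteq> V" using B by auto
  have vE: "v \<notin> \<Union>E" using fE pendant.hyps by auto
  have vw: "v \<noteq> w" using pendant.hyps by auto
  have dw: "vertex_degree E w \<ge> 1" using pendant D by simp
  note I = internal_vertices_pendant[OF fE pendant.hyps(3,2) dw]
  have vI: "v \<notin> internal_vertices E" "v \<notin> \<Union>C" using D pendant.hyps by auto
  have fin: "finite K" using pendant.prems B finite_subset by (metis finite_insert)
  show ?case
  proof (cases "w \<in> K")
    case False
    have "cover_sum ?E K = 0"
    proof (cases "v \<in> K")
      case True
      \<comment> \<open>Without w the vertex v is isolated in K, so connectivity leaves only K =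
        {v}, which covers no edge of E.\<close>
      have "K = {v}" if S: "S \<subseteq> ?E" "\<Union>S \<subseteq> K" "connected_graph K S" for S
      proof -
        have "e \<subseteq> {v} \<or> e \<inter> {v} = {}" if "e \<in> S" for e
          using S(1,2) that vE \<open>w \<notin> K\<close> by auto
        then have "x \<in> {v}" if "x \<in> K" for x
          using connected_graph_closed[OF S(3) True _ that, of "{v}"] by blast
        then have "K \<subseteq> {v}" by (rule subsetI)
        then show ?thesis using True by auto
      qed
      moreover obtain e where "e \<in> E" using B by auto
      ultimately show ?thesis using vE
        by (cases "K = {v}") (auto simp: cover_sum_def connected_sum_def intro!: sum.neutral)
    next
      case False
      then show ?thesis using \<open>w \<notin> K\<close> by (simp add: cover_sum_def)
    qed
    moreover have "\<not> internal_vertices ?E \<subseteq> K" using I(1) False by auto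
    \<comment> \<open>The vertex u would have to be w, but a cycle vertex already had degree at
      least 2 and now has at least 3.\<close>
    moreover have "\<not> (\<exists>u\<in>\<Union>C. internal_vertices ?E - K = {u} \<and> vertex_degree ?E u = 2)"
    proof
      assume "\<exists>u\<in>\<Union>C. internal_vertices ?E - K = {u} \<and> vertex_degree ?E u = 2"
      then obtain u where u: "u \<in> \<Union>C" "internal_vertices ?E - K = {u}" "vertex_degree ?E u = 2" by blast
      then have "u = w" using I(1) False by auto
      moreover have "u \<in> internal_vertices E" using u(1) D by auto
      ultimately show False using u(3) I(2) by (simp add: internal_vertex_def)
    qed
    ultimately show ?thesis by simp
  next
    case w: True
    define K0 where "K0 = K - {v}"
    have K0: "K0 \<subseteq> V" "K0 \<noteq> {}" "v \<notin> K0" "w \<in> K0" using pendant.prems w vw by (auto simp: K0_def)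
    have sub: "internal_vertices ?E \<subseteq> K \<longleftrightarrow> internal_vertices E \<subseteq> K0"
      using I(1) w vI vw by (auto simp: K0_def)
    have diff: "internal_vertices ?E - K = internal_vertices E - K0"
      using I(1) w vI vw by (auto simp: K0_def)
    define Q where "Q \<longleftrightarrow> (\<exists>u\<in>\<Union>C. internal_vertices E - K0 = {u} \<and> vertex_degree E u = 2)"
    have ex: "(\<exists>u\<in>\<Union>C. internal_vertices ?E - K = {u} \<and> vertex_degree ?E u = 2) \<longleftrightarrow> Q"
    proof -
      \<comment> \<open>The new edge does not touch u: w lies in K, and v is not on the
        cycle.\<close>
      have "vertex_degree ?E u = vertex_degree E u" if "u \<in> \<Union>C" "internal_vertices E - K0 = {u}" for u
        using that vI K0 by (intro I(3)) auto
      then show ?thesis unfolding diff Q_def by metis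
    qed
    have IH: "cover_sum E K0 =
      (if internal_vertices E \<subseteq> K0 then - ((-1) ^ card K0) * (of_nat (card (\<Union>C)) - 1)
       else if Q then - ((-1) ^ card K0) else 0)"
      unfolding Q_def using pendant.IH K0 by blast
    have cov: "(\<forall>e\<in>?E. e \<inter> K \<noteq> {}) \<longleftrightarrow> (\<forall>e\<in>E. e \<inter> K0 \<noteq> {})"
      using w vE by (auto simp: K0_def)
    show ?thesis
    proof (cases "v \<in> K")
      case True
      have K: "K = insert v K0" using True by (auto simp: K0_def)
      then have "connected_sum ?E K = - connected_sum E K0"
        using connected_sum_pendant[OF fE(1) K0(3) vE K0(4)] by simp
      then have "cover_sum ?E K = - cover_sum E K0" using cov by (simp add: cover_sum_def)
      moreover have "card K = Suc (card K0)" using K K0 fin by simp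
      ultimately show ?thesis unfolding sub ex IH by simp
    next
      case False
      then have K: "K0 = K" by (simp add: K0_def)
      have "{S. S \<subseteq> ?E \<and> \<Union>S \<subseteq> K \<and> connected_graph K S} = {S. S \<subseteq> E \<and> \<Union>S \<subseteq> K \<and> connected_graph K S}"
        using False by auto
      then have "cover_sum ?E K = cover_sum E K0"
        using cov by (simp add: cover_sum_def connected_sum_def K)
      then show ?thesis using IH unfolding sub ex K by simp
    qed
  qed
qed

section \<open>Chromatic symmetric functions and hook coefficients\<close>

lemma prod_of_bool: "finite A \<Longrightarrow> (\<Prod>x\<in>A. of_bool (P x)) = (of_bool (\<forall>x\<in>A. P x) :: 'a :: comm_semiring_1)"
  by (induction A rule: finite_induct) simp_all

lemma sum_Pow_minus_one: "finite F \<Longrightarrow> (\<Sum>S\<in>Pow F. (- 1) ^ card S) = (of_bool (F = {}) :: rat)"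
proof -
  assume F: "finite F"
  have "of_bool (F = {}) = (\<Prod>x\<in>F. 1 - (1 :: rat))" using F by (simp add: card_gt_0_iff)
  also have "\<dots> = (\<Sum>S\<in>Pow F. (- 1) ^ card S)" by (subst prod_diff_conv_sum[OF F]) simp
  finally show ?thesis by simp
qed

definition components :: "'a set \<Rightarrow> 'a set set \<Rightarrow> 'a set set" where
  "components V S = component_of S ` V"

lemma component_of_eq: "w \<in> component_of S v \<Longrightarrow> component_of S w = component_of S v"
proof -
  assume "w \<in> component_of S v"
  then have "(v, w) \<in> (adj S)\<^sup>*" by (simp add: component_of_def)
  moreover from this have "(w, v) \<in> (adj S)\<^sup>*" by (simp only: sym_adj_rtrancl)
  ultimately show ?thesis unfolding component_of_def by (auto intro: rtrancl_trans)
qed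

lemma self_in_component_of: "v \<in> component_of S v"
  by (simp add: component_of_def)

lemma component_of_subset:
  assumes "v \<in> V" "\<And>e. e \<in> S \<Longrightarrow> e \<subseteq> V"
  shows "component_of S v \<subseteq> V"
proof
  fix w assume "w \<in> component_of S v"
  then have "(v, w) \<in> (adj S)\<^sup>*" by (simp add: component_of_def)
  then show "w \<in> V" by (rule adj_rtrancl_closed) (use assms in auto)
qed

lemma components_partition:
  assumes "\<And>e. e \<in> S \<Longrightarrow> e \<subseteq> V"
  shows "\<Union>(components V S) = V" "pairwise disjnt (components V S)" "{} \<notin> components V S"
proof -
  show "\<Union>(components V S) = V"
    using self_in_component_of component_of_subset[OF _ assms] by (fastforce simp: components_def)
  show "pairwise disjnt (components V S)"
    unfolding components_def pairwise_def disjnt_iff using component_of_eq by (metis (no_types, lifting) imageE)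
  show "{} \<notin> components V S"
    using self_in_component_of by (fastforce simp: components_def)
qed

text \<open>Different blocks are colored independently, so each block contributes one power sum as a
  factor.\<close>

lemma color_series_partition:
  assumes "finite P" "pairwise disjnt P" "\<And>K. K \<in> P \<Longrightarrow> finite K \<and> K \<noteq> {}"
  shows "color_series (\<Union>P) (\<lambda>\<kappa>. \<Prod>K\<in>P. monochromatic K \<kappa>) = (\<Prod>K\<in>P. power_sum (card K))"
  using assms
proof (induction P)
  case empty
  show ?case using color_series_one[of "{}"] by simp
next
  case (insert K P)
  have disj: "K \<inter> \<Union>P = {}" using insert.prems(1) insert.hyps(2)
    by (auto simp: pairwise_insert disjnt_def)
  have restr: "monochromatic L (restrict \<kappa> W) = monochromatic L \<kappa>" if "L \<subseteq> W" for L W :: "'a set" and \<kappa>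
  proof -
    have "restrict \<kappa> W u = \<kappa> u" if "u \<in> L" for u using that \<open>L \<subseteq> W\<close> by auto
    then show ?thesis by (simp add: monochromatic_def)
  qed
  have "power_sum (card K) * (\<Prod>K\<in>P. power_sum (card K)) =
      color_series K (monochromatic K) * color_series (\<Union>P) (\<lambda>\<kappa>. \<Prod>K\<in>P. monochromatic K \<kappa>)"
    using insert.IH insert.prems by (simp add: power_sum_eq_color_series pairwise_insert)
  also have "\<dots> = color_series (K \<union> \<Union>P) (\<lambda>\<kappa>. monochromatic K \<kappa> * (\<Prod>K\<in>P. monochromatic K \<kappa>))"
    using insert disj by (intro color_series_mult prod.cong restr refl) auto
  finally show ?case using insert by simp
qed

text \<open>A coloring that is constant on every edge is constant along walks, hence on
  components.\<close>

lemma monochromatic_components: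
  assumes "finite S" "finite V" "\<And>e. e \<in> S \<Longrightarrow> e \<subseteq> V \<and> card e = 2"
  shows "(\<Prod>e\<in>S. monochromatic e \<kappa>) = (\<Prod>K\<in>components V S. monochromatic K \<kappa>)"
proof -
  let ?m = "\<lambda>K. \<forall>u\<in>K. \<forall>v\<in>K. \<kappa> u = \<kappa> v"
  have "(\<forall>e\<in>S. ?m e) \<longleftrightarrow> (\<forall>K\<in>components V S. ?m K)"
  proof
    assume m: "\<forall>e\<in>S. ?m e"
    have const: "\<kappa> v = \<kappa> w" if "(v, w) \<in> (adj S)\<^sup>*" for v w
      using that
    proof (induction rule: rtrancl_induct)
      case (step y z)
      then have "{y, z} \<in> S" by (simp add: adj_def)
      then have "\<kappa> y = \<kappa> z" using m[rule_format, of "{y, z}" y z] by simp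
      with step.IH show ?case by (rule trans)
    qed (rule refl)
    show "\<forall>K\<in>components V S. ?m K"
    proof (intro ballI)
      fix K u v assume "K \<in> components V S" "u \<in> K" "v \<in> K"
      then obtain x where "(x, u) \<in> (adj S)\<^sup>*" "(x, v) \<in> (adj S)\<^sup>*"
        by (auto simp: components_def component_of_def)
      from const[OF this(1)] const[OF this(2)] show "\<kappa> u = \<kappa> v" by (rule trans[OF sym])
    qed
  next
    assume m: "\<forall>K\<in>components V S. ?m K"
    show "\<forall>e\<in>S. ?m e"
    proof (intro ballI)
      fix e u v assume e: "e \<in> S" "u \<in> e" "v \<in> e"
      have "v \<in> component_of S u"
      proof (cases "u = v")
        case False
        then have "e = {u, v}" using assms(3)[OF e(1)] e by (auto simp: card_2_iff)
        then show ?thesis using e adj_rtrancl_edge by (simp add: component_of_def)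
      qed (simp add: self_in_component_of)
      moreover have "component_of S u \<in> components V S"
        using assms(3) e by (auto simp: components_def)
      ultimately show "\<kappa> u = \<kappa> v"
        using m[rule_format, of "component_of S u" u v] self_in_component_of[of u S] by simp
    qed
  qed
  then show ?thesis using assms(1,2)
    by (simp only: monochromatic_def prod_of_bool components_def finite_imageI)
qed

text \<open>Stanley's expansion: the indicator of properness is the product over all edges of one
  minus the indicator of a monochromatic edge, and S collects the factors that contribute their
  second term.\<close>

lemma chromatic_sf_power_sum:
  assumes G: "simple_graph V E"
  shows "chromatic_sf V E = (\<Sum>S\<in>Pow E. scale_pseries ((-1) ^ card S)
    (power_sum_prod (image_mset card (mset_set (components V S)))))"
proof -
  have V: "finite V" and E: "\<And>e. e \<in> E \<Longrightarrow> e \<subseteq> V \<and> card e = 2" using G by (auto simp: simple_graph_def)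
  have fE: "finite E" using V E by (auto intro: finite_subset[of _ "Pow V"])
  have "of_bool (\<forall>u v. {u, v} \<in> E \<longrightarrow> \<kappa> u \<noteq> \<kappa> v) =
      (\<Sum>S\<in>Pow E. (-1) ^ card S * (\<Prod>K\<in>components V S. monochromatic K \<kappa>))" for \<kappa> :: "'a \<Rightarrow> nat"
  proof -
    have "(\<forall>u v. {u, v} \<in> E \<longrightarrow> \<kappa> u \<noteq> \<kappa> v) \<longleftrightarrow> (\<forall>e\<in>E. \<not> (\<forall>u\<in>e. \<forall>v\<in>e. \<kappa> u = \<kappa> v))"
    proof
      assume p: "\<forall>u v. {u, v} \<in> E \<longrightarrow> \<kappa> u \<noteq> \<kappa> v"
      show "\<forall>e\<in>E. \<not> (\<forall>u\<in>e. \<forall>v\<in>e. \<kappa> u = \<kappa> v)"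
      proof
        fix e assume e: "e \<in> E"
        then obtain x y where "e = {x, y}" using E by (meson card_2_iff)
        with p e have neq: "\<kappa> x \<noteq> \<kappa> y" "x \<in> e" "y \<in> e" by auto
        show "\<not> (\<forall>u\<in>e. \<forall>v\<in>e. \<kappa> u = \<kappa> v)"
        proof
          assume A: "\<forall>u\<in>e. \<forall>v\<in>e. \<kappa> u = \<kappa> v"
          from neq(1) bspec[OF bspec[OF A neq(2)] neq(3)] show False by (rule notE)
        qed
      qed
    next
      assume p: "\<forall>e\<in>E. \<not> (\<forall>u\<in>e. \<forall>v\<in>e. \<kappa> u = \<kappa> v)"
      show "\<forall>u v. {u, v} \<in> E \<longrightarrow> \<kappa> u \<noteq> \<kappa> v"
      proof (intro allI impI notI)
        fix u v assume "{u, v} \<in> E" "\<kappa> u = \<kappa> v"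
        then have "\<forall>a\<in>{u, v}. \<forall>b\<in>{u, v}. \<kappa> a = \<kappa> b" by (simp add: eq_commute)
        with bspec[OF p \<open>{u, v} \<in> E\<close>] show False by (rule notE)
      qed
    qed
    then have "of_bool (\<forall>u v. {u, v} \<in> E \<longrightarrow> \<kappa> u \<noteq> \<kappa> v) = (\<Prod>e\<in>E. 1 - monochromatic e \<kappa>)"
      by (simp only: monochromatic_def of_bool_not_iff[symmetric] prod_of_bool[OF fE])
    also have "\<dots> = (\<Sum>S\<in>Pow E. (-1) ^ card S * (\<Prod>e\<in>S. monochromatic e \<kappa>))"
      by (subst prod_diff_conv_sum[OF fE]) simp
    also have "\<dots> = (\<Sum>S\<in>Pow E. (-1) ^ card S * (\<Prod>K\<in>components V S. monochromatic K \<kappa>))"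
    proof (rule sum.cong[OF refl])
      fix S assume S: "S \<in> Pow E"
      have "(\<Prod>e\<in>S. monochromatic e \<kappa>) = (\<Prod>K\<in>components V S. monochromatic K \<kappa>)"
        by (rule monochromatic_components) (use S E V fE finite_subset in auto)
      then show "(-1) ^ card S * (\<Prod>e\<in>S. monochromatic e \<kappa>) =
        (-1) ^ card S * (\<Prod>K\<in>components V S. monochromatic K \<kappa>)" by simp
    qed
    finally show ?thesis .
  qed
  then have "chromatic_sf V E =
      color_series V (\<lambda>\<kappa>. \<Sum>S\<in>Pow E. (-1) ^ card S * (\<Prod>K\<in>components V S. monochromatic K \<kappa>))"
    unfolding chromatic_sf_eq_color_series[OF V] by simp
  also have "\<dots> = (\<Sum>S\<in>Pow E. scale_pseries ((-1) ^ card S)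
      (color_series V (\<lambda>\<kappa>. \<Prod>K\<in>components V S. monochromatic K \<kappa>)))"
    by (rule color_series_sum)
  also have "\<dots> = (\<Sum>S\<in>Pow E. scale_pseries ((-1) ^ card S)
      (power_sum_prod (image_mset card (mset_set (components V S)))))"
  proof (rule sum.cong[OF refl])
    fix S assume S: "S \<in> Pow E"
    have "\<And>e. e \<in> S \<Longrightarrow> e \<subseteq> V" using S E by auto
    note P = components_partition[OF this]
    have "finite K \<and> K \<noteq> {}" if "K \<in> components V S" for K
      using P that V finite_subset[of K V] by (metis Sup_upper)
    from color_series_partition[OF _ P(2) this]
    have "color_series V (\<lambda>\<kappa>. \<Prod>K\<in>components V S. monochromatic K \<kappa>) = (\<Prod>K\<in>components V S. power_sum (card K))"
      using V P(1) by (simp add: components_def)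
    then show "scale_pseries ((-1) ^ card S) (color_series V (\<lambda>\<kappa>. \<Prod>K\<in>components V S. monochromatic K \<kappa>)) =
      scale_pseries ((-1) ^ card S) (power_sum_prod (image_mset card (mset_set (components V S))))"
      by (simp add: power_sum_prod_def prod_unfold_prod_mset multiset.map_comp o_def)
  qed
  finally show ?thesis .
qed

section \<open>Hook coefficients as sums over vertex sets\<close>

lemma star_rep_chromatic_sf:
  assumes G: "simple_graph V E" and h: "h > 0"
  shows "\<exists>x. star_rep h (card V) (chromatic_sf V E) x
    (\<Sum>S\<in>Pow E. (-1) ^ card S * (\<Sum>K\<in>components V S. (-1) ^ h * of_nat ((card K - 1) choose h)))"
proof -
  have V: "finite V" and E: "\<And>e. e \<in> E \<Longrightarrow> e \<subseteq> V" using G by (auto simp: simple_graph_def)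
  have rep: "star_rep h (card V) (power_sum_prod (image_mset card (mset_set (components V S)))) 1
      (\<Sum>K\<in>components V S. (-1) ^ h * of_nat ((card K - 1) choose h))" if S: "S \<in> Pow E" for S
  proof -
    have "\<And>e. e \<in> S \<Longrightarrow> e \<subseteq> V" using S E by auto
    note P = components_partition[OF this]
    have fin: "finite (components V S)" using V by (simp add: components_def)
    have finK: "finite K" if "K \<in> components V S" for K
      using P(1) that V finite_subset[of K V] by auto
    let ?p = "image_mset card (mset_set (components V S))"
    have "sum_mset ?p = (\<Sum>K\<in>components V S. card K)" by (simp add: sum_unfold_sum_mset)
    also have "\<dots> = card V"
      using card_Union_disjoint[of "components V S"] P finK by simp
    finally have sum: "sum_mset ?p = card V" .
    have nz: "0 \<notin># ?p" using fin finK P(3) by (auto simp: card_eq_0_iff)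
    show ?thesis using power_sum_prod_star_rep[OF h nz] unfolding sum
      by (simp add: sum_unfold_sum_mset multiset.map_comp o_def)
  qed
  show ?thesis
    unfolding chromatic_sf_power_sum[OF G] by (rule exI, rule star_rep_sum, erule rep)
qed

text \<open>A description in terms of the edges inside K and the edges off K, so that these can be
  chosen independently in \<open>cover_sum_eq\<close>.\<close>

lemma components_iff:
  assumes S: "\<And>e. e \<in> S \<Longrightarrow> e \<subseteq> V \<and> card e = 2" and K: "K \<subseteq> V"
  shows "K \<in> components V S \<longleftrightarrow>
    (\<forall>e\<in>S. e \<subseteq> K \<or> e \<inter> K = {}) \<and> connected_graph K {e \<in> S. e \<subseteq> K}"
proof
  assume "K \<in> components V S"
  then obtain v where v: "v \<in> V" "K = component_of S v" by (auto simp: components_def)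
  have nb: "b \<in> K" if "{a, b} \<in> S" "a \<in> K" for a b
    using that unfolding v component_of_def by (auto simp: adj_def intro: rtrancl_into_rtrancl)
  have "e \<subseteq> K \<or> e \<inter> K = {}" if e: "e \<in> S" for e
  proof -
    obtain a b where "e = {a, b}" using S[OF e] by (meson card_2_iff)
    with e nb[of a b] nb[of b a] show ?thesis by (auto simp: insert_commute)
  qed
  moreover have "connected_graph K {e \<in> S. e \<subseteq> K}"
  proof (rule connected_graphI[of v])
    show "v \<in> K" by (simp add: v self_in_component_of)
    fix y assume "y \<in> K"
    then have "(v, y) \<in> (adj S)\<^sup>*" by (simp add: v component_of_def)
    then show "(v, y) \<in> (adj {e \<in> S. e \<subseteq> K})\<^sup>*"
    proof (induction rule: rtrancl_induct)
      case (step y z)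
      have "{y, z} \<in> S" using step by (simp add: adj_def)
      moreover have "y \<in> K" using step by (simp add: v component_of_def)
      ultimately have "(y, z) \<in> adj {e \<in> S. e \<subseteq> K}" using nb by (simp add: adj_def)
      with step.IH show ?case by (rule rtrancl_into_rtrancl)
    qed simp
  qed
  ultimately show "(\<forall>e\<in>S. e \<subseteq> K \<or> e \<inter> K = {}) \<and> connected_graph K {e \<in> S. e \<subseteq> K}" by blast
next
  assume r: "(\<forall>e\<in>S. e \<subseteq> K \<or> e \<inter> K = {}) \<and> connected_graph K {e \<in> S. e \<subseteq> K}"
  then obtain x where x: "x \<in> K" by (auto simp: connected_graph_def)
  have "K = component_of S x"
  proof (intro equalityI subsetI)
    fix y assume "y \<in> K"
    then have "(x, y) \<in> (adj {e \<in> S. e \<subseteq> K})\<^sup>*" using r x by (simp add: connected_graph_def)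
    then have "(x, y) \<in> (adj S)\<^sup>*" by (rule adj_rtrancl_mono) auto
    then show "y \<in> component_of S x" by (simp add: component_of_def)
  next
    fix y assume "y \<in> component_of S x"
    then have "(x, y) \<in> (adj S)\<^sup>*" by (simp add: component_of_def)
    then show "y \<in> K" by (rule adj_rtrancl_closed) (use r x in auto)
  qed
  then show "K \<in> components V S" using x K by (auto simp: components_def)
qed

text \<open>An S with component K consists of a connected spanning edge set of K and an arbitrary
  set of edges disjoint from K. The alternating sum over the latter vanishes unless there are no
  such edges, which is the covering condition.\<close>

lemma cover_sum_eq:
  assumes fE: "finite E" and E: "\<And>e. e \<in> E \<Longrightarrow> e \<subseteq> V \<and> card e = 2" and K: "K \<subseteq> V"
  shows "(\<Sum>S | S \<subseteq> E \<and> K \<in> components V S. (-1) ^ card S) = cover_sum E K"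
proof -
  let ?A = "{S. S \<subseteq> E \<and> \<Union>S \<subseteq> K \<and> connected_graph K S}" and ?F = "{e \<in> E. e \<inter> K = {}}"
  let ?B = "{S. S \<subseteq> E \<and> K \<in> components V S}"
  have iff: "S \<in> ?B \<longleftrightarrow> S \<subseteq> E \<and> (\<forall>e\<in>S. e \<subseteq> K \<or> e \<inter> K = {}) \<and> connected_graph K {e \<in> S. e \<subseteq> K}" for S
    using components_iff[of S V K] E K by (simp add: subset_iff) blast
  \<comment> \<open>For nonempty edges, lying inside K and being disjoint from K exclude each
    other.\<close>
  have ne: "e \<noteq> {}" if "e \<in> E" for e using E[OF that] by auto
  have part: "{e \<in> S \<union> T. e \<subseteq> K} = S" "{e \<in> S \<union> T. e \<inter> K = {}} = T" "S \<inter> T = {}"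
    if "S \<in> ?A" "T \<in> Pow ?F" for S T
  proof -
    have a: "e \<subseteq> K \<and> e \<inter> K \<noteq> {}" if "e \<in> S" for e
      using \<open>S \<in> ?A\<close> that ne[of e] by auto
    have b: "e \<inter> K = {} \<and> \<not> e \<subseteq> K" if "e \<in> T" for e
      using \<open>T \<in> Pow ?F\<close> that ne[of e] by auto
    show "{e \<in> S \<union> T. e \<subseteq> K} = S" "{e \<in> S \<union> T. e \<inter> K = {}} = T" "S \<inter> T = {}"
    proof -
      show "{e \<in> S \<union> T. e \<subseteq> K} = S" "{e \<in> S \<union> T. e \<inter> K = {}} = T"
        by (rule set_eqI, use a b in blast)+
      show "S \<inter> T = {}" by (rule equals0I) (use a b in blast)
    qed
  qed
  have "(\<Sum>S\<in>?B. (-1) ^ card S) = (\<Sum>(S, T)\<in>?A \<times> Pow ?F. (-1) ^ card S * (-1 :: rat) ^ card T)"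
  proof (rule sum.reindex_bij_witness[of _ "\<lambda>(S, T). S \<union> T" "\<lambda>S. ({e \<in> S. e \<subseteq> K}, {e \<in> S. e \<inter> K = {}})"], goal_cases)
    case (1 S)
    then show ?case unfolding iff by auto
  next
    case (2 S)
    then show ?case unfolding iff by auto
  next
    case (3 ST)
    then obtain S T where ST: "ST = (S, T)" "S \<in> ?A" "T \<in> Pow ?F" by blast
    show ?case unfolding ST(1) prod.case part(1,2)[OF ST(2,3)] by (rule refl)
  next
    case (4 ST)
    then obtain S T where ST: "ST = (S, T)" "S \<in> ?A" "T \<in> Pow ?F" by blast
    have "S \<union> T \<subseteq> E" "\<forall>e\<in>S \<union> T. e \<subseteq> K \<or> e \<inter> K = {}" using ST by auto
    moreover have "connected_graph K {e \<in> S \<union> T. e \<subseteq> K}" unfolding part(1)[OF ST(2,3)] using ST by simp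
    ultimately have "S \<union> T \<in> ?B" unfolding iff by blast
    then show ?case unfolding ST by simp
  next
    case (5 S)
    have "S = {e \<in> S. e \<subseteq> K} \<union> {e \<in> S. e \<inter> K = {}}" using 5 unfolding iff by auto
    moreover have "{e \<in> S. e \<subseteq> K} \<inter> {e \<in> S. e \<inter> K = {}} = {}"
    proof (rule equals0I)
      fix e assume "e \<in> {e \<in> S. e \<subseteq> K} \<inter> {e \<in> S. e \<inter> K = {}}"
      moreover from this have "e \<noteq> {}" using 5 by (intro ne) auto
      ultimately show False by auto
    qed
    moreover have "finite S" using 5 fE finite_subset by blast
    ultimately have "card S = card {e \<in> S. e \<subseteq> K} + card {e \<in> S. e \<inter> K = {}}"
      by (metis (no_types, lifting) card_Un_disjoint finite_Un)
    then show ?case by (simp add: power_add)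
  qed
  also have "\<dots> = connected_sum E K * (\<Sum>T\<in>Pow ?F. (-1) ^ card T)"
    by (simp add: connected_sum_def sum_product sum.cartesian_product)
  also have "\<dots> = cover_sum E K"
    using fE by (subst sum_Pow_minus_one) (auto simp: cover_sum_def)
  finally show ?thesis .
qed

text \<open>Exchange of summation: f K is collected from all S that have K as a component.\<close>

lemma sum_components:
  assumes fV: "finite V" and fE: "finite E" and E: "\<And>e. e \<in> E \<Longrightarrow> e \<subseteq> V \<and> card e = 2"
  shows "(\<Sum>S\<in>Pow E. (-1) ^ card S * (\<Sum>K\<in>components V S. f K)) = (\<Sum>K\<in>Pow V. f K * cover_sum E K)"
proof -
  have "(\<Sum>S\<in>Pow E. (-1) ^ card S * (\<Sum>K\<in>components V S. f K)) =
      (\<Sum>S\<in>Pow E. \<Sum>K\<in>Pow V. if K \<in> components V S then (-1) ^ card S * f K else 0)"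
  proof (rule sum.cong[OF refl])
    fix S assume "S \<in> Pow E"
    then have "\<And>e. e \<in> S \<Longrightarrow> e \<subseteq> V" using E by auto
    from components_partition(1)[OF this] have "components V S \<subseteq> Pow V" by blast
    then have "{K \<in> Pow V. K \<in> components V S} = components V S" by auto
    then show "(-1) ^ card S * (\<Sum>K\<in>components V S. f K) =
        (\<Sum>K\<in>Pow V. if K \<in> components V S then (-1) ^ card S * f K else 0)"
      using fV by (simp add: sum_distrib_left flip: sum.inter_filter)
  qed
  also have "\<dots> = (\<Sum>K\<in>Pow V. \<Sum>S\<in>Pow E. if K \<in> components V S then (-1) ^ card S * f K else 0)"
    by (rule sum.swap)
  also have "\<dots> = (\<Sum>K\<in>Pow V. f K * cover_sum E K)"
  proof (rule sum.cong[OF refl])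
    fix K assume "K \<in> Pow V"
    then have K: "K \<subseteq> V" by simp
    have "(\<Sum>S\<in>Pow E. if K \<in> components V S then (-1) ^ card S * f K else 0) =
        (\<Sum>S | S \<subseteq> E \<and> K \<in> components V S. (-1) ^ card S * f K)"
      using fE by (simp flip: sum.inter_filter)
    also have "\<dots> = f K * cover_sum E K"
      by (simp add: cover_sum_eq[OF fE E K, symmetric] sum_distrib_left mult.commute)
    finally show "(\<Sum>S\<in>Pow E. if K \<in> components V S then (-1) ^ card S * f K else 0) = f K * cover_sum E K" .
  qed
  finally show ?thesis .
qed

text \<open>Each element of L applies the difference C(N, h) - C(N + 1, h) = -C(N, h - 1) once. The
  case |L| > h is separate because truncated subtraction would turn the lower index into 0.\<close>

lemma sum_Pow_choose:
  assumes "finite L"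
  shows "(\<Sum>S\<in>Pow L. (-1) ^ card S * of_nat ((N + card S) choose h)) =
    (-1) ^ card L * (if card L \<le> h then of_nat (N choose (h - card L)) else 0 :: rat)"
  using assms
proof (induction L arbitrary: N)
  case (insert x L)
  have "(\<Sum>S\<in>Pow (insert x L). (-1) ^ card S * of_nat ((N + card S) choose h)) =
    (\<Sum>S\<in>Pow L. (-1) ^ card S * of_nat ((N + card S) choose h)) +
    (\<Sum>S\<in>insert x ` Pow L. (-1) ^ card S * of_nat ((N + card S) choose h) :: rat)"
    unfolding Pow_insert by (rule sum.union_disjoint) (use insert.hyps in auto)
  also have "(\<Sum>S\<in>insert x ` Pow L. (-1) ^ card S * of_nat ((N + card S) choose h) :: rat) =
    (\<Sum>S\<in>Pow L. (-1) ^ card (insert x S) * of_nat ((N + card (insert x S)) choose h))"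
    by (rule sum.reindex[unfolded o_def]) (use insert.hyps in \<open>auto intro!: inj_onI\<close>)
  also have "\<dots> = (\<Sum>S\<in>Pow L. - ((-1) ^ card S * of_nat ((Suc N + card S) choose h)))"
  proof (rule sum.cong[OF refl])
    fix S assume "S \<in> Pow L"
    then have "card (insert x S) = Suc (card S)"
      using insert.hyps finite_subset by (intro card_insert_disjoint) auto
    then show "(-1) ^ card (insert x S) * of_nat ((N + card (insert x S)) choose h) =
        - ((-1) ^ card S * of_nat ((Suc N + card S) choose h) :: rat)" by simp
  qed
  finally have eq: "(\<Sum>S\<in>Pow (insert x L). (-1) ^ card S * of_nat ((N + card S) choose h)) =
      (\<Sum>S\<in>Pow L. (-1) ^ card S * of_nat ((N + card S) choose h)) -
      (\<Sum>S\<in>Pow L. (-1) ^ card S * of_nat ((Suc N + card S) choose h) :: rat)"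
    by (simp add: sum_negf)
  have card: "card (insert x L) = Suc (card L)" using insert.hyps by simp
  show ?case
  proof (cases "Suc (card L) \<le> h")
    case True
    then obtain d where "h = Suc (card L) + d" using le_Suc_ex by blast
    then show ?thesis unfolding eq insert.IH card by (simp add: algebra_simps Suc_diff_le)
  next
    case False
    then have "h = card L \<or> h < card L" by auto
    then show ?thesis unfolding eq insert.IH card by auto
  qed
qed simp

lemma sum_Pow_Int_eq:
  assumes "finite V" "J \<subseteq> I" "I \<subseteq> V"
  shows "(\<Sum>K | K \<subseteq> V \<and> K \<inter> I = J. f (card K)) = (\<Sum>S\<in>Pow (V - I). f (card J + card S))"
proof (rule sum.reindex_bij_witness[of _ "\<lambda>S. J \<union> S" "\<lambda>K. K - I"], goal_cases)
  case (5 K)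
  have "K = J \<union> (K - I)" "finite K" using 5 assms finite_subset by auto
  then have "card K = card J + card (K - I)"
    using card_Un_disjoint[of J "K - I"] assms finite_subset by (metis Diff_disjoint Int_lower2 disjoint_iff finite_Un subsetD)
  then show ?case by simp
qed (use assms in auto)

lemma card_rooted_tree_gt_1:
  assumes F: "finite V" "v \<in> V" "\<And>e. e \<in> F \<Longrightarrow> e \<subseteq> V \<and> card e = 2"
  shows "card (component_of F v) > 1 \<longleftrightarrow> (\<exists>e\<in>F. v \<in> e)"
proof
  assume c: "card (component_of F v) > 1"
  show "\<exists>e\<in>F. v \<in> e"
  proof (rule ccontr)
    assume "\<not> (\<exists>e\<in>F. v \<in> e)"
    then have "component_of F v \<subseteq> {v}"
      unfolding component_of_def using adj_rtrancl_closed[of v _ F "{v}"] by blast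
    then have "card (component_of F v) \<le> card {v}" by (intro card_mono) auto
    with c show False by simp
  qed
next
  assume "\<exists>e\<in>F. v \<in> e"
  then obtain e where e: "e \<in> F" "v \<in> e" by blast
  have "e \<subseteq> component_of F v"
  proof
    fix w assume "w \<in> e"
    then have "w = v \<or> {v, w} = e" using F(3)[OF e(1)] e(2) by (auto simp: card_2_iff)
    then show "w \<in> component_of F v"
      using e(1) by (auto simp: component_of_def intro: adj_rtrancl_edge)
  qed
  moreover have "finite (component_of F v)"
    using component_of_subset[OF F(2)] F(1,3) finite_subset by metis
  ultimately have "card e \<le> card (component_of F v)" by (intro card_mono)
  then show "card (component_of F v) > 1" using F(3)[OF e(1)] by simp
qed

text \<open>By \<open>pendant_extension_cover_sum\<close> only sets K whose trace on I is I or I -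
  {u} with u in D contribute. For a fixed trace, K varies by an arbitrary set of leaves, which
  \<open>sum_Pow_choose\<close> sums up.\<close>

lemma hook_coefficient:
  assumes ext: "pendant_extension C V E" and h: "h + m + 1 = card V"
  defines "I \<equiv> internal_vertices E" and "D \<equiv> {u \<in> \<Union>C. vertex_degree E u = 2}"
  assumes I3: "card I \<ge> 3"
  shows "(\<Sum>K\<in>Pow V. (-1) ^ h * of_nat ((card K - 1) choose h) * cover_sum E K) =
    (-1) ^ m * ((of_nat (card (\<Union>C)) - 1) * of_nat ((card I - 1) choose m)
      - of_nat (card D) * (if m = 0 then 0 else of_nat ((card I - 2) choose (m - 1))))"
proof -
  note B = pendant_extension_basic[OF ext] and deg = pendant_extension_degrees[OF ext]
  have fV: "finite V" using B by blast
  have IV: "I \<subseteq> V" and CI: "\<Union>C \<subseteq> I" using deg by (auto simp: I_def)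
  then have DI: "D \<subseteq> I" by (auto simp: D_def)
  have fI: "finite I" and fD: "finite D" using IV DI fV finite_subset by metis+
  \<comment> \<open>Everything in a summand that depends on |K| alone, including the sign that
    \<open>cover_sum\<close> contributes.\<close>
  define g :: "nat \<Rightarrow> rat" where "g j = - ((-1) ^ j) * ((-1) ^ h * of_nat ((j - 1) choose h))" for j
  define l where "l = card (V - I)"
  have kl: "card I + l = card V" unfolding l_def using card_Diff_subset[OF fI IV] card_mono[OF fV IV] by simp
  have cov: "cover_sum E K = of_bool (K \<inter> I = I) * (- ((-1) ^ card K) * (of_nat (card (\<Union>C)) - 1)) +
      (\<Sum>u\<in>D. of_bool (K \<inter> I = I - {u}) * - ((-1) ^ card K))" if K: "K \<in> Pow V" for K
  \<comment> \<open>The formula for \<open>cover_sum\<close> is stated for nonempty K. For K = {}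
    both sides vanish, since I minus a vertex is still nonempty.\<close>
  proof (cases "K = {}")
    case True
    have "\<not> connected_graph {} S" for S :: "'a set set" by (simp add: connected_graph_def)
    then have "cover_sum E K = 0" using True by (simp add: cover_sum_def connected_sum_def)
    moreover have "K \<inter> I \<noteq> I" using True I3 by auto
    moreover have "K \<inter> I \<noteq> I - {u}" for u
    proof
      assume "K \<inter> I = I - {u}"
      then have "I \<subseteq> {u}" using True by auto
      then have "card I \<le> card {u}" by (intro card_mono) auto
      then show False using I3 by simp
    qed
    ultimately show ?thesis by simp
  next
    case False
    have cs: "cover_sum E K =
      (if I \<subseteq> K then - ((-1) ^ card K) * (of_nat (card (\<Union>C)) - 1)
       else if \<exists>u\<in>\<Union>C. I - K = {u} \<and> vertex_degree E u = 2 then - ((-1) ^ card K) else 0)"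
      unfolding I_def using pendant_extension_cover_sum[OF ext _ False] K by simp
    have neq: "K \<inter> I = I - {u} \<longleftrightarrow> I - K = {u}" if "u \<in> D" for u using that DI by blast
    have "(\<Sum>u\<in>D. of_bool (K \<inter> I = I - {u}) * - ((-1) ^ card K)) =
        (if \<exists>u\<in>D. I - K = {u} then - ((-1) ^ card K) else (0 :: rat))"
    proof (cases "\<exists>u\<in>D. I - K = {u}")
      case True
      then obtain u where u: "u \<in> D" "I - K = {u}" by blast
      have "(\<Sum>u\<in>D. of_bool (K \<inter> I = I - {u}) * - ((-1) ^ card K)) =
          (\<Sum>u'\<in>D. if u' = u then - ((-1) ^ card K) else (0 :: rat))"
        by (rule sum.cong) (use u neq in auto)
      then show ?thesis using True u fD by simp
    next
      case False
      then have "(\<Sum>u\<in>D. of_bool (K \<inter> I = I - {u}) * - ((-1) ^ card K)) = (0 :: rat)"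
        by (intro sum.neutral) (use neq in auto)
      then show ?thesis using False by simp
    qed
    moreover have "(\<exists>u\<in>D. I - K = {u}) \<longleftrightarrow> (\<exists>u\<in>\<Union>C. I - K = {u} \<and> vertex_degree E u = 2)"
      unfolding D_def by blast
    moreover have "K \<inter> I = I \<longleftrightarrow> I \<subseteq> K" by blast
    moreover have "\<not> (\<exists>u\<in>D. I - K = {u})" if "I \<subseteq> K" using that by blast
    ultimately show ?thesis using cs by (cases "I \<subseteq> K") simp_all
  qed
  have sumJ: "(\<Sum>K\<in>Pow V. of_bool (K \<inter> I = J) * g (card K)) =
      - ((-1) ^ (card J + h + l)) * (if l \<le> h then of_nat ((card J - 1) choose (h - l)) else 0)"
    if J: "J \<subseteq> I" "card J \<ge> 1" for J
  proof -
    have "(\<Sum>K\<in>Pow V. of_bool (K \<inter> I = J) * g (card K)) = (\<Sum>K\<in>Pow V. if K \<inter> I = J then g (card K) else 0)"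
      by (rule sum.cong) auto
    also have "\<dots> = (\<Sum>K | K \<subseteq> V \<and> K \<inter> I = J. g (card K))"
      using fV by (simp flip: sum.inter_filter)
    also have "\<dots> = (\<Sum>S\<in>Pow (V - I). g (card J + card S))"
      by (rule sum_Pow_Int_eq[OF fV J(1) IV])
    also have "\<dots> = (\<Sum>S\<in>Pow (V - I). - ((-1) ^ (card J + h)) *
        ((-1) ^ card S * of_nat ((card J - 1 + card S) choose h)))"
      using J(2) by (intro sum.cong refl) (simp add: g_def power_add)
    also have "\<dots> = - ((-1) ^ (card J + h)) * (\<Sum>S\<in>Pow (V - I). (-1) ^ card S * of_nat ((card J - 1 + card S) choose h))"
      by (simp only: sum_distrib_left)
    also have "\<dots> = - ((-1) ^ (card J + h + l)) * (if l \<le> h then of_nat ((card J - 1) choose (h - l)) else 0)"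
      using fV by (subst sum_Pow_choose) (simp_all add: l_def power_add)
    finally show ?thesis .
  qed
  \<comment> \<open>From |I| + l = h + m + 1 the exponent is 2h + m + 1, whose parity is opposite to
    that of m.\<close>
  have sign: "- ((-1) ^ (card I + h + l)) = ((-1) ^ m :: rat)"
  proof -
    have eq: "card I + h + l = 2 * h + (m + 1)" using kl h by simp
    show ?thesis unfolding eq by (simp add: power_add power_mult)
  qed
  \<comment> \<open>The lower index h - l equals (|I| - 1) - m, complementary to m.\<close>
  have bin1: "(if l \<le> h then of_nat ((card I - 1) choose (h - l)) else 0) = (of_nat ((card I - 1) choose m) :: rat)"
  proof (cases "l \<le> h")
    case True
    then have "h - l = card I - 1 - m" "m \<le> card I - 1" using kl h I3 by simp_all
    then show ?thesis using True binomial_symmetric[of m "card I - 1"] by simp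
  next
    case False
    then have "card I - 1 < m" using kl h I3 by linarith
    then show ?thesis using False by simp
  qed
  \<comment> \<open>Here h - l = (|I| - 2) - (m - 1). For m = 0 this exceeds |I| - 2 and the
    coefficient is 0, which the truncated m - 1 would miss.\<close>
  have bin2: "(if l \<le> h then of_nat ((card I - 2) choose (h - l)) else 0) =
      (if m = 0 then 0 else of_nat ((card I - 2) choose (m - 1)) :: rat)"
  proof (cases "l \<le> h")
    case True
    show ?thesis
    proof (cases "m = 0")
      case True
      then have "card I - 2 < h - l" using kl h I3 by simp
      then show ?thesis using True by simp
    next
      case False
      then have "h - l = card I - 2 - (m - 1)" "m - 1 \<le> card I - 2" using \<open>l \<le> h\<close> kl h I3 by simp_all
      then show ?thesis using False \<open>l \<le> h\<close> binomial_symmetric[of "m - 1" "card I - 2"] by simp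
    qed
  next
    case False
    then have "card I - 2 < m - 1" "m \<noteq> 0" using kl h I3 by simp_all
    then show ?thesis using False by simp
  qed
  have "(\<Sum>K\<in>Pow V. (-1) ^ h * of_nat ((card K - 1) choose h) * cover_sum E K) =
      (\<Sum>K\<in>Pow V. (of_nat (card (\<Union>C)) - 1) * (of_bool (K \<inter> I = I) * g (card K)) +
        (\<Sum>u\<in>D. of_bool (K \<inter> I = I - {u}) * g (card K)))"
  proof (rule sum.cong[OF refl])
    have alg: "q * (b * (s * M) + (\<Sum>u\<in>D. f u * s)) = M * (b * (s * q)) + (\<Sum>u\<in>D. f u * (s * q))"
      for q b s M :: rat and f :: "'a \<Rightarrow> rat"
      by (simp add: distrib_left sum_distrib_left ac_simps)
    fix K assume K: "K \<in> Pow V"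
    show "(-1) ^ h * of_nat ((card K - 1) choose h) * cover_sum E K =
        (of_nat (card (\<Union>C)) - 1) * (of_bool (K \<inter> I = I) * g (card K)) +
        (\<Sum>u\<in>D. of_bool (K \<inter> I = I - {u}) * g (card K))"
      unfolding cov[OF K] g_def by (rule alg)
  qed
  also have "\<dots> = (of_nat (card (\<Union>C)) - 1) * (\<Sum>K\<in>Pow V. of_bool (K \<inter> I = I) * g (card K)) +
      (\<Sum>u\<in>D. \<Sum>K\<in>Pow V. of_bool (K \<inter> I = I - {u}) * g (card K))"
    unfolding sum.distrib sum_distrib_left by (subst sum.swap[of _ D]) (rule refl)
  also have "(\<Sum>u\<in>D. \<Sum>K\<in>Pow V. of_bool (K \<inter> I = I - {u}) * g (card K)) =
      (\<Sum>u\<in>D. - ((-1) ^ m) * (if m = 0 then 0 else of_nat ((card I - 2) choose (m - 1))))"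
  proof (rule sum.cong[OF refl])
    fix u assume "u \<in> D"
    then have c: "card (I - {u}) = card I - 1" using DI fI by auto
    \<comment> \<open>One vertex fewer than I flips the sign, which makes this contribution
      negative.\<close>
    then have sgn: "(-1 :: rat) ^ (card (I - {u}) + h + l) = (-1) ^ m"
      using sign I3 by (cases "card I") simp_all
    have c2: "card (I - {u}) - 1 = card I - 2" and "card (I - {u}) \<ge> 1" using c I3 by simp_all
    then show "(\<Sum>K\<in>Pow V. of_bool (K \<inter> I = I - {u}) * g (card K)) =
        - ((-1) ^ m) * (if m = 0 then 0 else of_nat ((card I - 2) choose (m - 1)))"
      using sumJ[of "I - {u}"] unfolding sgn c2 bin2 by blast
  qed
  also have "(\<Sum>K\<in>Pow V. of_bool (K \<inter> I = I) * g (card K)) = (-1) ^ m * of_nat ((card I - 1) choose m)"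
    using sumJ[of I] I3 unfolding sign bin1 by simp
  finally show ?thesis by (simp add: algebra_simps)
qed

text \<open>A cycle vertex has exactly two cycle edges, so a further edge at it, the beginning of a
  non-trivial tree, exists exactly if its degree is not 2.\<close>

lemma nontrivial_roots_eq:
  assumes ext: "pendant_extension C V E" and C: "the_cycle E = C"
  shows "nontrivial_roots E = {u \<in> \<Union>C. vertex_degree E u \<noteq> 2}"
proof -
  note B = pendant_extension_basic[OF ext] and deg = pendant_extension_degrees[OF ext]
  obtain vs where vs: "cycle_list vs" "C = cycle_edges vs"
    using ext by (induction) auto
  have "card (component_of (E - C) u) > 1 \<longleftrightarrow> vertex_degree E u \<noteq> 2" if u: "u \<in> \<Union>C" for u
  proof -
    have "u \<in> set vs" using u vs cycle_list.Union_cycle_edges by blast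
    then have d: "vertex_degree C u = 2" unfolding vs(2)
      using cycle_list.degree[OF vs(1)] by (auto simp: in_set_conv_nth)
    have "{e \<in> E. u \<in> e} = {e \<in> C. u \<in> e} \<union> {e \<in> E - C. u \<in> e}" using B by auto
    then have "vertex_degree E u = vertex_degree C u + card {e \<in> E - C. u \<in> e}"
      unfolding vertex_degree_def using B finite_subset[of C E] by (subst card_Un_disjoint[symmetric]) auto
    then have "vertex_degree E u \<noteq> 2 \<longleftrightarrow> {e \<in> E - C. u \<in> e} \<noteq> {}"
      using d B by (simp add: card_eq_0_iff)
    moreover have "card (component_of (E - C) u) > 1 \<longleftrightarrow> (\<exists>e\<in>E - C. u \<in> e)"
      by (rule card_rooted_tree_gt_1[of V]) (use B deg u in auto)
    ultimately show ?thesis by blast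
  qed
  then show ?thesis unfolding nontrivial_roots_def rooted_tree_def C by blast
qed

lemma int_binomial_of_nat: "int_binomial (int a) (int b) = of_nat (a choose b)"
  by (simp add: int_binomial_def)

theorem theorem3p3:
  fixes V :: "'a set" and E :: "'a set set" and n c k r m1 :: nat
  assumes "simple_graph V E" and "connected_graph V E" and "unicyclic E"
    and "n = card V"
    and "c = card (\<Union>(the_cycle E))" and "c \<ge> 3"
    and "k = card (internal_edges E)"
    and "r = card (nontrivial_roots E)"
    and "m1 \<le> n - 2"
  shows "star_coeff n (chromatic_sf V E) (hook n m1) =
    (- 1) ^ m1 * ((of_nat r - 1) * int_binomial (int k - 2) (int m1 - 1)
                + (of_nat c - 1) * int_binomial (int k - 2) (int m1))"
proof -
  define C where "C = the_cycle E"
  have ex1: "\<exists>!C. is_cycle E C" using assms(3) by (simp add: unicyclic_def)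
  have C: "is_cycle E C" unfolding C_def the_cycle_def by (rule theI'[OF ex1])
  then have uniq: "D = C" if "is_cycle E D" for D using ex1 that by blast
  have ext: "pendant_extension C V E"
    by (rule unicyclic_pendant_extension[OF assms(1,2) C uniq])
  note B = pendant_extension_basic[OF ext] and deg = pendant_extension_degrees[OF ext]
  let ?I = "internal_vertices E" and ?D = "{u \<in> \<Union>C. vertex_degree E u = 2}"
  have fV: "finite V" and fC: "finite (\<Union>C)" and fI: "finite ?I"
    using B deg finite_subset by metis+
  have k: "k = card ?I" using assms(7) deg by simp
  have c: "c = card (\<Union>C)" using assms(5) by (simp add: C_def)
  have "c \<le> k" unfolding k c using deg fI by (intro card_mono) auto
  then have k3: "k \<ge> 3" using assms(6) by simp
  have "k \<le> n" unfolding k assms(4) using deg fV by (intro card_mono) auto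
  then have n3: "n \<ge> 3" using k3 by simp
  have "r = card (\<Union>C - ?D)"
    unfolding assms(8) nontrivial_roots_eq[OF ext C_def[symmetric]] by (rule arg_cong[of _ _ card]) auto
  moreover have sub: "?D \<subseteq> \<Union>C" by blast
  \<comment> \<open>The cycle vertices of degree 2 are those with a trivial tree, c - r in
    number.\<close>
  ultimately have D: "card ?D + r = c"
    unfolding c using card_Diff_subset[OF finite_subset[OF sub fC] sub] card_mono[OF fC sub] by linarith
  define h where "h = n - 1 - m1"
  \<comment> \<open>The bound on m1 is what makes h positive.\<close>
  have h: "h > 0" "h < n" "n - 1 - h = m1" "h + m1 + 1 = card V"
    using assms(4,9) n3 by (simp_all add: h_def)
  obtain x where "star_rep h (card V) (chromatic_sf V E) x
    (\<Sum>S\<in>Pow E. (-1) ^ card S * (\<Sum>K\<in>components V S. (-1) ^ h * of_nat ((card K - 1) choose h)))"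
    using star_rep_chromatic_sf[OF assms(1) h(1)] by blast
  then have "star_rep h n (chromatic_sf V E) x
    (\<Sum>K\<in>Pow V. (-1) ^ h * of_nat ((card K - 1) choose h) * cover_sum E K)"
    unfolding assms(4) using B by (subst (asm) sum_components) auto
  from star_coeff_hook[OF this h(1,2)]
  have "star_coeff n (chromatic_sf V E) (hook n m1) =
    (-1) ^ m1 * ((of_nat c - 1) * of_nat ((k - 1) choose m1)
      - of_nat (card ?D) * (if m1 = 0 then 0 else of_nat ((k - 2) choose (m1 - 1))))"
    unfolding h(3) using hook_coefficient[OF ext h(4)] k3 unfolding k c by simp
  also have "of_nat (card ?D) = (of_nat c - of_nat r :: rat)" using D by (simp flip: D)
  \<comment> \<open>For m1 = 0 the lower index is -1, and \<open>int_binomial\<close> is 0 there by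
    definition.\<close>
  also have "(if m1 = 0 then 0 else of_nat ((k - 2) choose (m1 - 1))) = int_binomial (int k - 2) (int m1 - 1)"
  proof (cases m1)
    case (Suc j)
    then show ?thesis using int_binomial_of_nat[of "k - 2" j] k3 by (simp add: of_nat_diff)
  qed (simp add: int_binomial_def)
  \<comment> \<open>Pascal's rule brings both terms to the upper index k - 2, where c - 1 and -(c -
    r) combine to r - 1.\<close>
  also have "of_nat ((k - 1) choose m1) = int_binomial (int k - 2) (int m1 - 1) + int_binomial (int k - 2) (int m1)"
  proof (cases m1)
    case 0
    then show ?thesis using k3 by (simp add: int_binomial_def)
  next
    case (Suc j)
    have "k - 1 = Suc (k - 2)" using k3 by simp
    then have "(k - 1) choose m1 = ((k - 2) choose j) + ((k - 2) choose Suc j)" unfolding Suc by (simp only: binomial_Suc_Suc)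
    then show ?thesis
      using int_binomial_of_nat[of "k - 2" j] int_binomial_of_nat[of "k - 2" "Suc j"] k3 Suc
      by (simp add: of_nat_diff)
  qed
  finally show ?thesis by (simp add: algebra_simps)
qed

end
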